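(* Let $m,p\in\mathbb{N}_0$, let $a_i\in\mathbb{R}$, $\alpha_i>0$ with $a_i+\alpha_i>0$ for $i=1,\dots,p$, and let $b_j\in\mathbb{R}$, $\beta_j>0$ with $b_j+\beta_j>0$ for $j=1,\dots,m$. Assume that $H^{m,0}_{p,m}(x)=H^{m,0}_{p,m}\left[x\,\Big|{(a_i,\alpha_i)_{1,p}\atop(b_j,\beta_j)_{1,m}}\right]$ is non-negative on $(0,\infty)$, that $a^*=\Delta=\sum_{j=1}^m\beta_j-\sum_{i=1}^p\alpha_i>0$, and that the poles $b_{jl}=-\frac{b_j+l}{\beta_j}$ ($j=1,\dots,m$, $l\in\mathbb{N}_0$) are simple. Then $$H^{m,0}_{p,m}(x)=O\Big(x^{(\Re(\mu)+1/2)/\Delta}\exp\big(-\Delta\,\delta^{-1/\Delta}x^{1/\Delta}\big)\Big),\quad x\to+\infty,$$ and $$H^{m,0}_{p,m}(x)=O(x^\rho),\quad x\to0^+,\qquad\text{where}\quad\rho:=\min_{j=1,\dots,m}\left[\frac{b_j}{\beta_j}\right]>-1.$$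
   Context: Fox-$H$ function: $$H^{m,0}_{p,m}\left[x\,\Big|{(a_i,\alpha_i)_{1,p}\atop(b_j,\beta_j)_{1,m}}\right]=\frac1{2\pi\mathrm{i}}\int_{\mathcal{L}}\frac{\prod_{j=1}^m\Gamma(b_j+s\beta_j)}{\prod_{i=1}^p\Gamma(a_i+s\alpha_i)}x^{-s}\,\mathrm{d}s,\quad x>0,$$ with $\mathcal{L}$ a contour from $\gamma-\mathrm{i}\infty$ to $\gamma+\mathrm{i}\infty$ ($\gamma\in\mathbb{R}$) having all the poles $b_{jl}$ on its left; empty products are $1$, empty sums $0$. In the formula for $\rho$, $[\,\cdot\,]$ are plain brackets. Constants: $\mu=\sum_{j=1}^mb_j-\sum_{i=1}^pa_i+(p-m)/2$ and $\delta=\prod_{j=1}^m\beta_j^{\beta_j}\prod_{i=1}^p\alpha_i^{-\alpha_i}$. *)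

theory Defs
  imports "HOL-Complex_Analysis.Complex_Analysis" "HOL-Library.Landau_Symbols"
begin

text \<open>
  Parameters are functions on \<open>nat\<close>; only their values on \<open>{1..p}\<close> (for \<open>a\<close>, \<open>\<alpha>\<close>) and
  \<open>{1..m}\<close> (for \<open>b\<close>, \<open>\<beta>\<close>) matter.
\<close>

definition foxH_numerator ::
    "nat \<Rightarrow> (nat \<Rightarrow> real) \<Rightarrow> (nat \<Rightarrow> real) \<Rightarrow> complex \<Rightarrow> complex" where
  "foxH_numerator m b \<beta> s = (\<Prod>j=1..m. Gamma (of_real (b j) + s * of_real (\<beta> j)))"

text \<open>
  Since \<open>Gamma\<close> is \<open>0\<close> at its poles and \<open>x / 0 = 0\<close>, the quotient below takes the correct value \<open>0\<close>
  where a factor of the denominator has a pole and the numerator is finite.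
\<close>
definition foxH_integrand ::
    "nat \<Rightarrow> nat \<Rightarrow> (nat \<Rightarrow> real) \<Rightarrow> (nat \<Rightarrow> real) \<Rightarrow> (nat \<Rightarrow> real) \<Rightarrow> (nat \<Rightarrow> real) \<Rightarrow>
     real \<Rightarrow> complex \<Rightarrow> complex" where
  "foxH_integrand m p a \<alpha> b \<beta> x s =
     foxH_numerator m b \<beta> s / (\<Prod>i=1..p. Gamma (of_real (a i) + s * of_real (\<alpha> i)))
       * complex_of_real x powr (- s)"

definition foxH_pole :: "(nat \<Rightarrow> real) \<Rightarrow> (nat \<Rightarrow> real) \<Rightarrow> nat \<Rightarrow> nat \<Rightarrow> complex" where
  "foxH_pole b \<beta> j l = of_real (- (b j + real l) / \<beta> j)"

text \<open>
  An infinite contour is a map from the whole real line; \<open>subpath (- T) T L\<close> is its restriction to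
  \<open>{- T..T}\<close>, reparametrised over \<open>{0..1}\<close>.
\<close>
definition vertical_contour :: "real \<Rightarrow> (real \<Rightarrow> complex) \<Rightarrow> bool" where
  "vertical_contour \<gamma> L \<longleftrightarrow>
     (\<forall>T>0. valid_path (subpath (- T) T L)) \<and>
     ((\<lambda>t. Re (L t)) \<longlongrightarrow> \<gamma>) at_top \<and> ((\<lambda>t. Re (L t)) \<longlongrightarrow> \<gamma>) at_bot \<and>
     filterlim (\<lambda>t. Im (L t)) at_top at_top \<and> filterlim (\<lambda>t. Im (L t)) at_bot at_bot"

text \<open>
  \<open>z\<close> lies to the left of an upward contour iff the argument of \<open>L t - z\<close> increases by \<open>\<pi>\<close> in total
  along \<open>L\<close>; to the right it decreases by \<open>\<pi>\<close>. For a path that is not closed, the real part of the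
  winding number is the change of argument divided by \<open>2 * \<pi>\<close>.
\<close>
definition left_of_contour :: "(real \<Rightarrow> complex) \<Rightarrow> complex \<Rightarrow> bool" where
  "left_of_contour L z \<longleftrightarrow>
     z \<notin> range L \<and> ((\<lambda>T. Re (winding_number (subpath (- T) T L) z)) \<longlongrightarrow> 1 / 2) at_top"

definition foxH_contour ::
    "nat \<Rightarrow> (nat \<Rightarrow> real) \<Rightarrow> (nat \<Rightarrow> real) \<Rightarrow> real \<Rightarrow> (real \<Rightarrow> complex) \<Rightarrow> bool" where
  "foxH_contour m b \<beta> \<gamma> L \<longleftrightarrow>
     vertical_contour \<gamma> L \<and> (\<forall>j\<in>{1..m}. \<forall>l. left_of_contour L (foxH_pole b \<beta> j l))"

definition foxH ::
    "(real \<Rightarrow> complex) \<Rightarrow> nat \<Rightarrow> nat \<Rightarrow> (nat \<Rightarrow> real) \<Rightarrow> (nat \<Rightarrow> real) \<Rightarrow> (nat \<Rightarrow> real) \<Rightarrow>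
     (nat \<Rightarrow> real) \<Rightarrow> real \<Rightarrow> complex" where
  "foxH L m p a \<alpha> b \<beta> x =
     1 / (2 * of_real pi * \<i>) *
     Lim at_top (\<lambda>T. contour_integral (subpath (- T) T L) (foxH_integrand m p a \<alpha> b \<beta> x))"

definition foxH_Delta :: "nat \<Rightarrow> nat \<Rightarrow> (nat \<Rightarrow> real) \<Rightarrow> (nat \<Rightarrow> real) \<Rightarrow> real" where
  "foxH_Delta m p \<alpha> \<beta> = (\<Sum>j=1..m. \<beta> j) - (\<Sum>i=1..p. \<alpha> i)"

definition foxH_mu :: "nat \<Rightarrow> nat \<Rightarrow> (nat \<Rightarrow> real) \<Rightarrow> (nat \<Rightarrow> real) \<Rightarrow> real" where
  "foxH_mu m p a b = (\<Sum>j=1..m. b j) - (\<Sum>i=1..p. a i) + (real p - real m) / 2"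

definition foxH_delta :: "nat \<Rightarrow> nat \<Rightarrow> (nat \<Rightarrow> real) \<Rightarrow> (nat \<Rightarrow> real) \<Rightarrow> real" where
  "foxH_delta m p \<alpha> \<beta> = (\<Prod>j=1..m. \<beta> j powr \<beta> j) * (\<Prod>i=1..p. \<alpha> i powr (- \<alpha> i))"

definition foxH_rho :: "nat \<Rightarrow> (nat \<Rightarrow> real) \<Rightarrow> (nat \<Rightarrow> real) \<Rightarrow> real" where
  "foxH_rho m b \<beta> = (MIN j\<in>{1..m}. b j / \<beta> j)"

definition simple_pole_at :: "(complex \<Rightarrow> complex) \<Rightarrow> complex \<Rightarrow> bool" where
  "simple_pole_at f z \<longleftrightarrow> is_pole f z \<and> zorder f z = - 1"

end

theory Submission
  imports Defs "HOL-Real_Asymp.Real_Asymp"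
begin

text \<open>
  Both estimates rest on the freedom to choose the abscissa \<open>c\<close> of the line of integration. Write the
  integrand as \<open>K(s) x\<^sup>-\<^sup>s\<close>, where the kernel \<open>K\<close> is the quotient of Gamma products.

  \<^item> \<^emph>\<open>From the contour to a line.\<close> All poles are real, and both tails of the contour eventually stay in
    the open upper and lower half-plane, where \<open>Ln(w - z)\<close> is a primitive of \<open>1/(w - z)\<close> for every
    pole \<open>z\<close>. Closing a truncated contour by a rectangular detour on the right therefore gives a closed path
    whose winding number about a pole is independent of the truncation. Lying to the left of the
    contour makes its real part tend to \<open>0\<close>, so it is \<open>0\<close>, and Cauchy's theorem replaces the contour
    by any vertical line to the right of the poles (\<open>contour_integral_tendsto_vertical_line\<close>). The
    horizontal pieces vanish because \<open>K\<close> decays in vertical strips (\<open>foxH_kernel_strip_decay\<close>).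

  \<^item> \<^emph>\<open>At infinity.\<close> Stirling's formula for the modulus, uniformly in a right half-plane
    (\<open>Gamma_Stirling_bounds\<close>), bounds each Gamma factor from both sides and hence \<open>|K(s)|\<close>. The saddle point of
    \<open>K(s) x\<^sup>-\<^sup>s\<close> is essentially \<open>c = (x/\<delta>)\<^bsup>1/\<Delta>\<^esup>\<close>, and on the line through it the modulus at \<open>c + \<i>t\<close> is at most a
    constant times \<open>c\<^sup>\<mu> e\<^bsup>-\<Delta>c\<^esup> / (1 + \<Delta>t\<^sup>2/(4c))\<close> (\<open>foxH_kernel_saddle_bound\<close>). Integration over \<open>t\<close> costs a factor \<open>\<surd>c\<close>, which is
    the \<open>1/2\<close> in the exponent. Since the phase is stationary at the saddle point, absolute values lose
    only a constant.

  \<^item> \<^emph>\<open>At zero.\<close> The rightmost pole is \<open>-\<rho>\<close>, and its simplicity means that exactly one Gamma factor is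
    singular there (\<open>simple_pole_of_numerator_unique\<close>). Moving the line slightly past it leaves a residue of size \<open>x\<^sup>\<rho>\<close>
    and an integral of smaller order (\<open>shift_line_past_simple_pole\<close>).
\<close>

section \<open>Stirling's formula for the modulus of the Gamma function\<close>

lemma norm_Ln_approx_quadratic:
  fixes u :: complex
  assumes "norm u \<le> 1/2"
  shows "norm (Ln (1 + u) - u + u\<^sup>2 / 2) \<le> 2 * norm u ^ 3"
proof -
  let ?f = "\<lambda>u::complex. Ln (1 + u) - u + u\<^sup>2 / 2"
  have Re: "Re (1 + v) > 0" if "v \<in> cball 0 (norm u)" for v :: complex
    using that assms abs_Re_le_cmod[of v] by auto
  have "norm (?f u - ?f 0) \<le> 2 * norm u ^ 2 * norm (u - 0)"
  proof (rule field_differentiable_bound[where S = "cball 0 (norm u)" and f' = "\<lambda>v. v\<^sup>2 / (1 + v)"])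
    fix v :: complex assume v: "v \<in> cball 0 (norm u)"
    have ne: "1 + v \<noteq> 0" and np: "1 + v \<notin> \<real>\<^sub>\<le>\<^sub>0"
      using Re[OF v] by (auto simp: complex_nonpos_Reals_iff complex_eq_iff)
    show "(?f has_field_derivative v\<^sup>2 / (1 + v)) (at v within cball 0 (norm u))"
    proof (rule DERIV_cong)
      show "(?f has_field_derivative 1 / (1 + v) - 1 + v) (at v within cball 0 (norm u))"
        using np by (auto intro!: derivative_eq_intros simp: field_simps)
      show "1 / (1 + v) - 1 + v = v\<^sup>2 / (1 + v)"
        using ne by (simp add: divide_simps) (simp add: algebra_simps power2_eq_square)
    qed
    have "norm (1 + v) \<ge> 1/2"
      using norm_triangle_ineq2[of 1 "-v"] v assms by auto
    moreover have "norm v ^ 2 \<le> norm u ^ 2" using v by (intro power_mono) auto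
    ultimately have "norm v ^ 2 / norm (1 + v) \<le> norm u ^ 2 / (1/2)"
      by (intro frac_le) auto
    thus "norm (v\<^sup>2 / (1 + v)) \<le> 2 * norm u ^ 2"
      by (simp add: norm_divide norm_power)
  qed auto
  thus ?thesis by (simp add: power3_eq_cube power2_eq_square mult.assoc)
qed

lemma norm_Ln_approx_linear:
  fixes u :: complex
  assumes "norm u \<le> 1/2"
  shows "norm (Ln (1 + u) - u) \<le> 2 * norm u ^ 2"
proof -
  have "norm (Ln (1 + u) - u) \<le> norm u^2 / (1 - norm u)"
    using assms by (intro Ln_approx_linear) auto
  also have "\<dots> \<le> norm u^2 / (1/2)"
    using assms by (intro divide_left_mono) auto
  finally show ?thesis by simp
qed

lemma Ln_add_right_half_plane:
  fixes w :: complex and r :: real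
  assumes "Re w > 0" "r \<ge> 0"
  shows "Ln (w + of_real r) = Ln w + Ln (1 + of_real r / w)"
proof -
  have w: "w \<noteq> 0" using assms by auto
  have "Re (of_real r / w) = r * Re w / (norm w)\<^sup>2"
    unfolding complex_div_cnj[of "of_real r" w] by (simp flip: of_real_power)
  hence "Re (of_real r / w) \<ge> 0" using assms by simp
  hence "Re (1 + of_real r / w) > 0" by simp
  hence u: "\<bar>Im (Ln (1 + of_real r / w))\<bar> < pi/2" "1 + of_real r / w \<noteq> 0"
    by (rule Re_Ln_pos_lt_imp, metis less_irrefl zero_complex.sel(1))
  moreover have "\<bar>Im (Ln w)\<bar> < pi/2" using assms Re_Ln_pos_lt_imp by auto
  ultimately have "Ln (w * (1 + of_real r / w)) = Ln w + Ln (1 + of_real r / w)"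
    using w by (intro Ln_times_simple) auto
  moreover have "w * (1 + of_real r / w) = w + of_real r"
    using w by (simp add: field_simps)
  ultimately show ?thesis by simp
qed

lemma add_real_notin_nonpos_Ints:
  assumes "Re w > 0" "norm w > \<bar>b\<bar>"
  shows "w + of_real b \<notin> \<int>\<^sub>\<le>\<^sub>0"
proof
  assume "w + of_real b \<in> \<int>\<^sub>\<le>\<^sub>0"
  hence "Im w = 0" "Re w + b \<le> 0" by (auto elim!: nonpos_Ints_cases simp: complex_eq_iff)
  moreover from this(1) have "norm w = Re w" using assms(1) by (simp add: cmod_def)
  ultimately show False using assms by auto
qed

text \<open>
  Including the shift \<open>b\<close> in the Stirling main term avoids expanding logarithms of \<open>w + b\<close>.
\<close>

definition stirling_main :: "real \<Rightarrow> complex \<Rightarrow> complex" where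
  "stirling_main b w = exp ((w + of_real b - 1/2) * Ln w - w)"

definition stirling_quotient :: "real \<Rightarrow> complex \<Rightarrow> complex" where
  "stirling_quotient b w = Gamma (w + of_real b) / stirling_main b w"

text \<open>
  The logarithm of the ratio of consecutive Stirling quotients. For \<open>b = 0\<close> it is the general term of
  Gudermann's series for the remainder in Stirling's formula.
\<close>

definition gudermann_term :: "real \<Rightarrow> complex \<Rightarrow> complex" where
  "gudermann_term b w = (w + of_real b + 1/2) * Ln (1 + 1 / w) - 1 - Ln (1 + of_real b / w)"

lemma stirling_quotient_step:
  assumes "Re w > 0" "norm w > \<bar>b\<bar>"
  shows "stirling_quotient b w = stirling_quotient b (w + 1) * exp (gudermann_term b w)"
proof -
  have w: "w \<noteq> 0" using assms by auto
  have wb: "w + of_real b \<noteq> 0"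
    using assms(2) by (metis add_eq_0_iff norm_minus_cancel norm_of_real order_less_irrefl)
  have L: "Ln (w + 1) = Ln w + Ln (1 + 1 / w)"
    using Ln_add_right_half_plane[OF assms(1), of 1] by simp
  have b: "exp (Ln (1 + of_real b / w)) = (w + of_real b) / w"
  proof -
    have "1 + of_real b / w = (w + of_real b) / w" using w by (simp add: field_simps)
    thus ?thesis using w wb by (simp add: exp_Ln)
  qed
  have "Gamma (w + 1 + of_real b) = (w + of_real b) * Gamma (w + of_real b)"
    using Gamma_plus1[OF add_real_notin_nonpos_Ints[OF assms]] by (simp add: add_ac)
  have "stirling_main b (w + 1) = stirling_main b w * (w + of_real b) * exp (gudermann_term b w)"
  proof -
    have "w + of_real b = w * exp (Ln (1 + of_real b / w))" using b w by simp
    also have "\<dots> = exp (Ln w + Ln (1 + of_real b / w))" using w by (simp add: exp_add)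
    finally have "stirling_main b w * (w + of_real b) * exp (gudermann_term b w) =
      exp (((w + of_real b - 1/2) * Ln w - w) + (Ln w + Ln (1 + of_real b / w)) + gudermann_term b w)"
      by (simp add: stirling_main_def exp_add)
    also have "\<dots> = stirling_main b (w + 1)"
      unfolding stirling_main_def L gudermann_term_def by (simp add: algebra_simps)
    finally show ?thesis ..
  qed
  thus ?thesis unfolding stirling_quotient_def
    using \<open>Gamma (w + 1 + of_real b) = _\<close> wb
    by (simp add: stirling_main_def)
qed

text \<open>
  The linear terms of \<open>Ln(1 + 1/w)\<close> and \<open>Ln(1 + b/w)\<close> together with the quadratic term of the former cancel all
  contributions of order \<open>1\<close> and \<open>1/w\<close>; this is what the power \<open>b - 1/2\<close> in the main term is for.
\<close>

lemma norm_gudermann_term_le: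
  assumes "norm w \<ge> 2" "norm w \<ge> 2 * \<bar>b\<bar>"
  shows "norm (gudermann_term b w) \<le> (3 + 2 * \<bar>b\<bar> + 2 * b\<^sup>2) / norm w ^ 2"
proof -
  define u where "u = 1 / w"
  have w: "w \<noteq> 0" using assms by auto
  have nu: "norm u = 1 / norm w" by (simp add: u_def norm_divide)
  have u: "norm u \<le> 1/2" using assms w by (simp add: nu divide_simps)
  have bu: "norm (of_real b * u) \<le> 1/2"
    using assms w by (simp add: nu norm_mult divide_simps)
  have "gudermann_term b w = w * (Ln (1 + u) - u + u\<^sup>2 / 2) + (of_real b + 1/2) * (Ln (1 + u) - u)
          - (Ln (1 + of_real b * u) - of_real b * u)"
    using w unfolding gudermann_term_def u_def by (simp add: field_simps power2_eq_square)
  also have "norm \<dots> \<le> norm (w * (Ln (1 + u) - u + u\<^sup>2 / 2)) + norm ((of_real b + 1/2) * (Ln (1 + u) - u))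
          + norm (Ln (1 + of_real b * u) - of_real b * u)"
    by (rule order.trans[OF norm_triangle_ineq4]) (use norm_triangle_ineq in auto)
  also have "\<dots> \<le> norm w * (2 * norm u ^ 3) + (\<bar>b\<bar> + 1/2) * (2 * norm u ^ 2) + 2 * norm (of_real b * u) ^ 2"
  proof (intro add_mono)
    show "norm (w * (Ln (1 + u) - u + u\<^sup>2 / 2)) \<le> norm w * (2 * norm u ^ 3)"
      unfolding norm_mult by (intro mult_left_mono norm_Ln_approx_quadratic u) auto
    have "norm (of_real b + 1/2 :: complex) \<le> \<bar>b\<bar> + 1/2"
      by (rule order.trans[OF norm_triangle_ineq]) auto
    thus "norm ((of_real b + 1/2) * (Ln (1 + u) - u)) \<le> (\<bar>b\<bar> + 1/2) * (2 * norm u ^ 2)"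
      unfolding norm_mult by (intro mult_mono norm_Ln_approx_linear u) auto
  qed (rule norm_Ln_approx_linear[OF bu])
  also have "\<dots> = (3 + 2 * \<bar>b\<bar> + 2 * b\<^sup>2) / norm w ^ 2"
    using w by (simp add: nu norm_mult field_simps power2_eq_square power3_eq_cube)
  finally show ?thesis .
qed

text \<open>
  The terms at \<open>w + n\<close> are \<open>O(1/(1 + n\<^sup>2))\<close> uniformly for \<open>Re w > 0\<close> and \<open>|w|\<close> large, because then \<open>|w + n|\<^sup>2 \<ge> |w|\<^sup>2 + n\<^sup>2\<close>.
  So the Stirling quotient changes along \<open>w, w + 1, w + 2, \<dots>\<close> by a factor bounded independently of \<open>w\<close>.
\<close>

lemma stirling_quotient_bounded_by_shift:
  fixes b :: real
  obtains B where "\<And>w N. Re w > 0 \<Longrightarrow> norm w \<ge> max 2 (2 * \<bar>b\<bar> + 1) \<Longrightarrow>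
     norm (stirling_quotient b w) \<le> exp B * norm (stirling_quotient b (w + of_nat N)) \<and>
     norm (stirling_quotient b (w + of_nat N)) \<le> exp B * norm (stirling_quotient b w)"
proof -
  define M where "M = 3 + 2 * \<bar>b\<bar> + 2 * b\<^sup>2"
  have M: "M \<ge> 0" by (simp add: M_def)
  define q where "q = (\<lambda>n. 2 * M * inverse (real (Suc n) ^ 2))"
  have "summable (\<lambda>n. inverse (real (Suc n) ^ 2))"
    using inverse_power_summable[of 2, where 'a = real] by (subst summable_Suc_iff) auto
  hence sq: "summable q" unfolding q_def by (intro summable_mult)
  define B where "B = suminf q"
  show ?thesis
  proof (rule that[of B])
    fix w :: complex and N :: nat
    assume w: "Re w > 0" "norm w \<ge> max 2 (2 * \<bar>b\<bar> + 1)"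
    have sq_le: "norm w ^ 2 + real n ^ 2 \<le> norm (w + of_nat n) ^ 2" for n
      using w(1) by (simp add: cmod_power2 power2_sum)
    have ge: "norm w \<le> norm (w + of_nat n)" for n
    proof -
      have "norm w ^ 2 \<le> norm (w + of_nat n) ^ 2"
        using sq_le[of n] zero_le_power2[of "real n"] by linarith
      thus ?thesis by (rule power2_le_imp_le) auto
    qed
    define G where "G = (\<lambda>N. \<Sum>n<N. gudermann_term b (w + of_nat n))"
    have eq: "stirling_quotient b w = stirling_quotient b (w + of_nat N) * exp (G N)" for N
    proof (induction N)
      case (Suc N)
      have "norm (w + of_nat N) > \<bar>b\<bar>" using ge[of N] w(2) by linarith
      hence "stirling_quotient b (w + of_nat N) =
         stirling_quotient b (w + of_nat N + 1) * exp (gudermann_term b (w + of_nat N))"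
        using w by (intro stirling_quotient_step) auto
      with Suc show ?case by (simp add: G_def exp_add algebra_simps)
    qed (simp add: G_def)
    have term_le: "norm (gudermann_term b (w + of_nat n)) \<le> q n" for n
    proof -
      have "norm (gudermann_term b (w + of_nat n)) \<le> M / norm (w + of_nat n) ^ 2"
        unfolding M_def using ge[of n] w(2) by (intro norm_gudermann_term_le) linarith+
      also have "\<dots> \<le> M / (real (Suc n) ^ 2 / 2)"
      proof (intro divide_left_mono M)
        have "real (Suc n) ^ 2 / 2 \<le> 1 + real n ^ 2"
          using sum_squares_bound[of 1 "real n"] by (simp add: power2_eq_square algebra_simps)
        also have "\<dots> \<le> norm w ^ 2 + real n ^ 2" using w(2) by simp
        also have "\<dots> \<le> norm (w + of_nat n) ^ 2" by (rule sq_le)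
        finally show "real (Suc n) ^ 2 / 2 \<le> norm (w + of_nat n) ^ 2" .
        have "norm (w + of_nat n) > 0" using ge[of n] w(2) by linarith
        thus "0 < norm (w + of_nat n) ^ 2 * (real (Suc n) ^ 2 / 2)" by simp
      qed
      finally show ?thesis by (simp add: q_def field_simps)
    qed
    have GB: "norm (G N) \<le> B"
    proof -
      have "norm (G N) \<le> (\<Sum>n<N. q n)" unfolding G_def by (intro sum_norm_le term_le)
      also have "\<dots> \<le> B" unfolding B_def
        using M by (intro sum_le_suminf sq) (auto simp: q_def)
      finally show ?thesis .
    qed
    have "norm (exp (G N)) \<le> exp B"
      using GB abs_Re_le_cmod[of "G N"] by simp
    moreover have "norm (exp (- G N)) \<le> exp B"
      using GB abs_Re_le_cmod[of "G N"] by simp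
    moreover have "norm (stirling_quotient b w) = norm (exp (G N)) * norm (stirling_quotient b (w + of_nat N))"
      by (subst eq[of N]) (simp add: norm_mult)
    moreover have "norm (stirling_quotient b (w + of_nat N)) = norm (exp (- G N)) * norm (stirling_quotient b w)"
      by (subst eq[of N]) (simp add: norm_mult exp_minus norm_inverse)
    ultimately show "norm (stirling_quotient b w) \<le> exp B * norm (stirling_quotient b (w + of_nat N)) \<and>
     norm (stirling_quotient b (w + of_nat N)) \<le> exp B * norm (stirling_quotient b w)"
      by (metis mult_right_mono norm_ge_zero)
  qed
qed

text \<open>
  Euler's limit \<open>\<Gamma>(z + N) \<sim> \<Gamma>(N) N\<^sup>z\<close> compares the quotients at \<open>w + N\<close> with those at the integers, so that
  the value of the constant \<open>\<surd>(2\<pi>)\<close> never enters.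
\<close>

lemma stirling_quotient_shift_limit:
  assumes "Re w > 0" "w + of_real b \<notin> \<int>\<^sub>\<le>\<^sub>0"
  shows "(\<lambda>N. stirling_quotient b (w + of_nat N) / stirling_quotient 0 (of_nat N)) \<longlonglongrightarrow> 1"
proof -
  define z where "z = w + of_real b"
  have z: "z \<notin> \<int>\<^sub>\<le>\<^sub>0" using assms by (simp add: z_def)
  hence Gz: "Gamma z \<noteq> 0" by (simp add: Gamma_eq_zero_iff)
  have "(\<lambda>N. Gamma z / Gamma_series' z N) \<longlonglongrightarrow> Gamma z / Gamma z"
    by (intro tendsto_intros Gamma_series'_LIMSEQ Gz)
  hence lim1: "(\<lambda>N. Gamma z / Gamma_series' z N) \<longlonglongrightarrow> 1" using Gz by simp
  define v where "v = (\<lambda>N. w / of_nat N)"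
  have v0: "v \<longlonglongrightarrow> 0" unfolding v_def by (rule lim_const_over_n)
  have evv: "eventually (\<lambda>N. norm (v N) < 1/2) sequentially"
    using tendstoD[OF v0, of "1/2"] by simp
  have Lv: "(\<lambda>N. Ln (1 + v N)) \<longlonglongrightarrow> 0"
    using tendsto_Ln[of "\<lambda>N. 1 + v N" 1 sequentially] tendsto_add[OF tendsto_const v0, of 1] by simp
  have NLv: "(\<lambda>N. of_nat N * Ln (1 + v N)) \<longlonglongrightarrow> w"
  proof -
    have "(\<lambda>N. of_nat N * Ln (1 + v N) - w) \<longlonglongrightarrow> 0"
    proof (rule Lim_null_comparison)
      show "(\<lambda>N. 2 * norm w ^ 2 / real N) \<longlonglongrightarrow> 0"
        by (rule lim_const_over_n)
      show "eventually (\<lambda>N. norm (of_nat N * Ln (1 + v N) - w) \<le> 2 * norm w ^ 2 / real N) sequentially"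
        using evv eventually_gt_at_top[of 0]
      proof eventually_elim
        case (elim N)
        have "of_nat N * Ln (1 + v N) - w = of_nat N * (Ln (1 + v N) - v N)"
          using elim by (simp add: v_def field_simps)
        also have "norm \<dots> \<le> real N * (2 * norm (v N) ^ 2)"
          unfolding norm_mult using elim by (intro mult_mono norm_Ln_approx_linear) auto
        also have "\<dots> = 2 * norm w ^ 2 / real N"
          using elim by (simp add: v_def norm_divide field_simps power2_eq_square)
        finally show ?case .
      qed
    qed
    thus ?thesis by (simp add: LIM_zero_iff)
  qed
  have "(\<lambda>N. Gamma z / Gamma_series' z N * exp (w - (of_nat N * Ln (1 + v N) + (w + of_real b - 1/2) * Ln (1 + v N))))
          \<longlonglongrightarrow> 1 * exp (w - (w + (w + of_real b - 1/2) * 0))"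
    by (intro tendsto_intros lim1 NLv Lv)
  hence "(\<lambda>N. Gamma z / Gamma_series' z N * exp (w - (of_nat N * Ln (1 + v N) + (w + of_real b - 1/2) * Ln (1 + v N)))) \<longlonglongrightarrow> 1"
    by simp
  thus ?thesis
  proof (rule Lim_transform_eventually)
    show "eventually (\<lambda>N. Gamma z / Gamma_series' z N * exp (w - (of_nat N * Ln (1 + v N) + (w + of_real b - 1/2) * Ln (1 + v N)))
            = stirling_quotient b (w + of_nat N) / stirling_quotient 0 (of_nat N)) sequentially"
      using eventually_gt_at_top[of 0]
    proof eventually_elim
      case (elim N)
      have Nw: "Ln (w + of_nat N) = of_real (ln (real N)) + Ln (1 + v N)"
      proof -
        have "Ln (w + of_nat N) = Ln (of_nat N * (1 + v N))"
          using elim by (simp add: v_def distrib_left add.commute)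
        also have "\<dots> = of_real (ln (real N)) + Ln (1 + v N)"
        proof (subst Ln_times_of_nat)
          have "w + of_nat N \<noteq> 0" using assms(1) by (auto simp: complex_eq_iff)
          moreover have "1 + v N = (w + of_nat N) / of_nat N" using elim by (simp add: v_def field_simps)
          ultimately show "1 + v N \<noteq> 0" using elim by simp
        qed (use elim in \<open>auto simp: Ln_of_nat\<close>)
        finally show ?thesis .
      qed
      have LN: "Ln (of_nat N) = of_real (ln (real N))"
        using elim by (metis Ln_of_nat)
      have G1: "Gamma (of_nat N :: complex) = fact (N - 1)"
        using Gamma_fact[of "N - 1", where 'a = complex] elim by (cases N) (auto simp: add.commute)
      have G2: "Gamma z / Gamma_series' z N = Gamma (z + of_nat N) / (fact (N - 1) * exp (z * of_real (ln (of_nat N))))"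
        using Gz pochhammer_Gamma[OF z, of N] by (simp add: Gamma_series'_def field_simps)
      have zN: "w + of_nat N + of_real b = z + of_nat N" by (simp add: z_def)
      have "stirling_quotient b (w + of_nat N) / stirling_quotient 0 (of_nat N) =
         Gamma (z + of_nat N) / fact (N - 1) * (stirling_main 0 (of_nat N) / stirling_main b (w + of_nat N))"
        unfolding stirling_quotient_def zN using G1 by simp
      also have "stirling_main 0 (of_nat N) / stirling_main b (w + of_nat N) =
         exp (- (z * of_real (ln (of_nat N))) + (w - (of_nat N * Ln (1 + v N) + (w + of_real b - 1/2) * Ln (1 + v N))))"
        unfolding stirling_main_def Nw LN exp_diff[symmetric]
        by (rule arg_cong[of _ _ exp]) (simp add: z_def algebra_simps)
      also have "\<dots> = inverse (exp (z * of_real (ln (of_nat N)))) *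
           exp (w - (of_nat N * Ln (1 + v N) + (w + of_real b - 1/2) * Ln (1 + v N)))"
        by (simp only: exp_add exp_minus)
      finally show ?case unfolding G2 by (simp only: divide_inverse inverse_mult_distrib mult.assoc)
    qed
  qed
qed

text \<open>
  Far to the right the quotient at \<open>w + N\<close> is comparable with the one at \<open>N\<close>, hence with its value at \<open>2\<close>; both comparisons
  transport back to \<open>w\<close> with uniform constants.
\<close>

lemma Gamma_Stirling_bounds:
  fixes b :: real
  obtains C R where "C > 0" "R > 0"
    "\<And>w. Re w > 0 \<Longrightarrow> norm w \<ge> R \<Longrightarrow> norm (Gamma (w + of_real b)) \<le> C * norm (stirling_main b w)"
    "\<And>w. Re w > 0 \<Longrightarrow> norm w \<ge> R \<Longrightarrow> norm (stirling_main b w) \<le> C * norm (Gamma (w + of_real b))"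
proof -
  obtain B where B: "\<And>w N. Re w > 0 \<Longrightarrow> norm w \<ge> max 2 (2 * \<bar>b\<bar> + 1) \<Longrightarrow>
     norm (stirling_quotient b w) \<le> exp B * norm (stirling_quotient b (w + of_nat N)) \<and>
     norm (stirling_quotient b (w + of_nat N)) \<le> exp B * norm (stirling_quotient b w)"
    by (rule stirling_quotient_bounded_by_shift[of b]) blast
  obtain B0 where B0: "\<And>w N. Re w > 0 \<Longrightarrow> norm w \<ge> max 2 (2 * \<bar>0\<bar> + 1) \<Longrightarrow>
     norm (stirling_quotient 0 w) \<le> exp B0 * norm (stirling_quotient 0 (w + of_nat N)) \<and>
     norm (stirling_quotient 0 (w + of_nat N)) \<le> exp B0 * norm (stirling_quotient 0 w)"
    by (rule stirling_quotient_bounded_by_shift[of 0]) blast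
  define K where "K = norm (stirling_quotient 0 2)"
  have K: "K > 0"
    by (auto simp: K_def stirling_quotient_def stirling_main_def Gamma_eq_zero_iff)
  define C where "C = max (exp B * 2 * exp B0 * K) (exp B * 2 * exp B0 / K)"
  define R where "R = max 2 (2 * \<bar>b\<bar> + 1)"
  have main: "norm (stirling_quotient b w) \<le> C \<and> 1 \<le> C * norm (stirling_quotient b w)"
    if w: "Re w > 0" "norm w \<ge> R" for w
  proof -
    have wb: "w + of_real b \<notin> \<int>\<^sub>\<le>\<^sub>0"
      using w by (intro add_real_notin_nonpos_Ints) (auto simp: R_def)
    have "(\<lambda>N. norm (stirling_quotient b (w + of_nat N) / stirling_quotient 0 (of_nat N))) \<longlonglongrightarrow> norm (1::complex)"
      by (intro tendsto_norm stirling_quotient_shift_limit w(1) wb)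
    hence "eventually (\<lambda>N. dist (norm (stirling_quotient b (w + of_nat N) / stirling_quotient 0 (of_nat N))) 1 < 1/2) sequentially"
      by (intro tendstoD) auto
    with eventually_ge_at_top[of 2] have ev: "eventually (\<lambda>N. N \<ge> 2 \<and>
          dist (norm (stirling_quotient b (w + of_nat N) / stirling_quotient 0 (of_nat N))) 1 < 1/2) sequentially"
      by eventually_elim auto
    obtain N where N: "N \<ge> 2" and
      "dist (norm (stirling_quotient b (w + of_nat N) / stirling_quotient 0 (of_nat N))) 1 < 1/2"
      using eventually_happens'[OF sequentially_bot ev] by auto
    define X where "X = norm (stirling_quotient b (w + of_nat N))"
    define Y where "Y = norm (stirling_quotient 0 (of_nat N))"
    have "\<bar>X / Y - 1\<bar> < 1/2"
      using \<open>dist _ 1 < 1/2\<close> by (simp add: norm_divide dist_real_def X_def Y_def)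
    obtain n where n: "N = 2 + n" using N le_Suc_ex by blast
    have N2: "of_nat N = (2 + of_nat n :: complex)" by (simp add: n)
    have Y1: "K \<le> exp B0 * Y" "Y \<le> exp B0 * K"
      using B0[of 2 n] unfolding Y_def K_def N2 by auto
    have Y0: "Y > 0" using Y1(1) K by (smt (verit) exp_gt_zero mult_nonneg_nonpos)
    have XY: "X \<le> 2 * Y" "Y \<le> 2 * X"
    proof -
      define q where "q = X / Y"
      have "q \<le> 2" "1 \<le> 2 * q" using \<open>\<bar>X / Y - 1\<bar> < 1/2\<close> unfolding q_def[symmetric] by linarith+
      moreover have "X = q * Y" using Y0 by (simp add: q_def)
      ultimately show "X \<le> 2 * Y" "Y \<le> 2 * X"
        using Y0 mult_right_mono[of q 2 Y] mult_right_mono[of 1 "2 * q" Y] by simp_all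
    qed
    define Z where "Z = norm (stirling_quotient b w)"
    have Z: "Z \<le> exp B * X" "X \<le> exp B * Z"
      using B[of w N] w unfolding Z_def X_def R_def by auto
    have "Z \<le> exp B * X" by fact
    also have "\<dots> \<le> exp B * (2 * Y)" using XY by simp
    also have "\<dots> \<le> exp B * (2 * (exp B0 * K))" using Y1 by simp
    also have "\<dots> \<le> C" by (simp add: C_def)
    finally have 1: "Z \<le> C" .
    have "K \<le> exp B0 * Y" by fact
    also have "\<dots> \<le> exp B0 * (2 * X)" using XY by simp
    also have "\<dots> \<le> exp B0 * (2 * (exp B * Z))" using Z by simp
    finally have "1 \<le> (exp B * 2 * exp B0 / K) * Z" using K by (simp add: field_simps)
    also have "\<dots> \<le> C * Z" unfolding C_def Z_def by (intro mult_right_mono) auto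
    finally show ?thesis using 1 by (simp add: Z_def)
  qed
  have pos: "norm (stirling_main b w) > 0" for w by (simp add: stirling_main_def)
  show ?thesis
  proof (rule that[of C R])
    show "C > 0" unfolding C_def using K by (simp add: less_max_iff_disj)
    show "R > 0" by (simp add: R_def)
    fix w :: complex assume w: "Re w > 0" "norm w \<ge> R"
    show "norm (Gamma (w + of_real b)) \<le> C * norm (stirling_main b w)"
      using main[OF w] pos[of w] by (simp add: stirling_quotient_def norm_divide field_simps)
    show "norm (stirling_main b w) \<le> C * norm (Gamma (w + of_real b))"
      using main[OF w] pos[of w] by (simp add: stirling_quotient_def norm_divide field_simps)
  qed
qed

section \<open>The size of the kernel\<close>

lemma ln_one_plus_square_le_mult_arctan: "ln (1 + u\<^sup>2) \<le> u * arctan u" for u :: real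
proof -
  have den: "1 + x\<^sup>2 > 0" for x :: real by (simp add: add_pos_nonneg)
  have 1: "x / (1 + x\<^sup>2) \<le> arctan x" if "x \<ge> 0" for x :: real
  proof -
    let ?f = "\<lambda>x::real. arctan x - x / (1 + x\<^sup>2)"
    have "?f 0 \<le> ?f x"
    proof (rule DERIV_nonneg_imp_nondecreasing[OF that])
      fix y :: real assume "0 \<le> y" "y \<le> x"
      have "(?f has_real_derivative 1 / (1 + y\<^sup>2) - ((1 + y\<^sup>2) - y * (2 * y)) / (1 + y\<^sup>2)\<^sup>2) (at y)"
        using den[of y] by (auto intro!: derivative_eq_intros simp: inverse_eq_divide power2_eq_square)
      moreover have "1 / (1 + y\<^sup>2) - ((1 + y\<^sup>2) - y * (2 * y)) / (1 + y\<^sup>2)\<^sup>2 = 2 * y\<^sup>2 / (1 + y\<^sup>2)\<^sup>2"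
        using den[of y] by (simp add: divide_simps) (simp add: algebra_simps power2_eq_square)
      ultimately show "\<exists>d. (?f has_real_derivative d) (at y) \<and> 0 \<le> d"
        by (metis divide_nonneg_nonneg mult_nonneg_nonneg zero_le_numeral zero_le_power2)
    qed
    thus ?thesis by simp
  qed
  have 2: "ln (1 + x\<^sup>2) \<le> x * arctan x" if "x \<ge> 0" for x :: real
  proof -
    let ?f = "\<lambda>x::real. x * arctan x - ln (1 + x\<^sup>2)"
    have "?f 0 \<le> ?f x"
    proof (rule DERIV_nonneg_imp_nondecreasing[OF that])
      fix y :: real assume y: "0 \<le> y" "y \<le> x"
      have "(?f has_real_derivative (arctan y - y / (1 + y\<^sup>2))) (at y)"
        using den[of y] by (auto intro!: derivative_eq_intros simp: divide_simps)
      thus "\<exists>d. (?f has_real_derivative d) (at y) \<and> 0 \<le> d"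
        using 1[OF y(1)] by fastforce
    qed
    thus ?thesis by simp
  qed
  show ?thesis
    using 2[of u] 2[of "-u"] by (cases "u \<ge> 0") (auto simp: arctan_minus)
qed

lemma ln_one_plus_slope_square:
  assumes "Re s > 0"
  shows "ln (1 + (Im s / Re s)\<^sup>2) = 2 * (ln (norm s) - ln (Re s))"
proof -
  have s: "s \<noteq> 0" using assms by auto
  have "1 + (Im s / Re s)\<^sup>2 = (norm s / Re s)\<^sup>2"
    using assms by (simp add: cmod_power2 field_simps)
  also have "ln \<dots> = 2 * ln (norm s / Re s)"
    using assms s by (subst ln_realpow) auto
  finally show ?thesis using assms s by (simp add: ln_div)
qed

text \<open>
  Replaces the argument of \<open>s\<close> in \<open>|s\<^sup>s|\<close> by \<open>ln|s|\<close>. The bound is weak far from the real axis, but it is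
  sharp to second order near the axis and gives decay like \<open>|s|\<^bsup>-Re s\<^esup>\<close>; this suffices both near
  the saddle point and for convergence.
\<close>

lemma Re_mult_Ln_le:
  assumes "Re s > 0"
  shows "Re (s * Ln s) \<le> 2 * Re s * ln (Re s) - Re s * ln (norm s)"
proof -
  define u where "u = Im s / Re s"
  have s: "s \<noteq> 0" using assms by auto
  have "Im (Ln s) = arctan u"
    using arg_conv_arctan[OF assms] s by (simp add: Arg_eq_Im_Ln u_def)
  hence "Re (s * Ln s) = Re s * ln (norm s) - Re s * (u * arctan u)"
    using assms s by (simp add: u_def)
  also have "\<dots> \<le> Re s * ln (norm s) - Re s * ln (1 + u\<^sup>2)"
    using assms ln_one_plus_square_le_mult_arctan[of u] by simp
  also have "ln (1 + u\<^sup>2) = 2 * (ln (norm s) - ln (Re s))"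
    unfolding u_def by (rule ln_one_plus_slope_square[OF assms])
  finally show ?thesis by (simp add: algebra_simps)
qed

text \<open>
  The logarithm of \<open>|\<Gamma>(b + \<beta>s)|\<close> up to a bounded error, expressed through \<open>Ln s\<close> so that the exponents of different
  factors can be added.
\<close>

definition stirling_exponent :: "real \<Rightarrow> real \<Rightarrow> complex \<Rightarrow> real" where
  "stirling_exponent b \<beta> s =
     Re ((of_real \<beta> * s + of_real (b - 1/2)) * Ln s) - \<beta> * Re s + \<beta> * ln \<beta> * Re s"

lemma Gamma_affine_bounds:
  assumes "\<beta> > 0"
  shows "\<exists>C R. C > 0 \<and> (\<forall>s. Re s > 0 \<longrightarrow> norm s \<ge> R \<longrightarrow>
    norm (Gamma (of_real b + s * of_real \<beta>)) \<le> C * exp (stirling_exponent b \<beta> s) \<and>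
    exp (stirling_exponent b \<beta> s) \<le> C * norm (Gamma (of_real b + s * of_real \<beta>)))"
proof -
  obtain C R where C: "C > 0" "R > 0"
    and up: "\<And>w. Re w > 0 \<Longrightarrow> norm w \<ge> R \<Longrightarrow> norm (Gamma (w + of_real b)) \<le> C * norm (stirling_main b w)"
    and lo: "\<And>w. Re w > 0 \<Longrightarrow> norm w \<ge> R \<Longrightarrow> norm (stirling_main b w) \<le> C * norm (Gamma (w + of_real b))"
    using Gamma_Stirling_bounds[of b] by metis
  define k where "k = (b - 1/2) * ln \<beta>"
  define C' where "C' = C * exp \<bar>k\<bar>"
  have main: "norm (stirling_main b (s * of_real \<beta>)) = exp k * exp (stirling_exponent b \<beta> s)"
    if "Re s > 0" for s
  proof -
    have s: "s \<noteq> 0" using that by auto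
    have L: "Ln (s * of_real \<beta>) = of_real (ln \<beta>) + Ln s"
      using Ln_times_of_real[of \<beta> s] assms s by (simp add: mult.commute Ln_of_real)
    have "norm (stirling_main b (s * of_real \<beta>)) =
       exp (Re ((s * of_real \<beta> + of_real b - 1/2) * (of_real (ln \<beta>) + Ln s) - s * of_real \<beta>))"
      unfolding stirling_main_def L by simp
    also have "Re ((s * of_real \<beta> + of_real b - 1/2) * (of_real (ln \<beta>) + Ln s) - s * of_real \<beta>) =
        k + stirling_exponent b \<beta> s"
      by (simp add: stirling_exponent_def k_def algebra_simps)
    finally show ?thesis by (simp add: exp_add)
  qed
  have "norm (Gamma (of_real b + s * of_real \<beta>)) \<le> C' * exp (stirling_exponent b \<beta> s) \<and>
    exp (stirling_exponent b \<beta> s) \<le> C' * norm (Gamma (of_real b + s * of_real \<beta>))"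
    if s: "Re s > 0" "norm s \<ge> R / \<beta>" for s
  proof -
    have w: "Re (s * of_real \<beta>) > 0" "norm (s * of_real \<beta>) \<ge> R"
      using s assms by (simp_all add: norm_mult field_simps)
    have "norm (Gamma (of_real b + s * of_real \<beta>)) \<le> C * (exp k * exp (stirling_exponent b \<beta> s))"
      using up[OF w] main[OF s(1)] by (simp add: add.commute)
    also have "\<dots> \<le> C * (exp \<bar>k\<bar> * exp (stirling_exponent b \<beta> s))"
      using C by (intro mult_left_mono mult_right_mono) auto
    finally have 1: "norm (Gamma (of_real b + s * of_real \<beta>)) \<le> C' * exp (stirling_exponent b \<beta> s)"
      by (simp add: C'_def mult.assoc)
    have "exp (stirling_exponent b \<beta> s) = exp (-k) * norm (stirling_main b (s * of_real \<beta>))"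
      using main[OF s(1)] by (simp flip: exp_add mult.assoc)
    also have "\<dots> \<le> exp \<bar>k\<bar> * (C * norm (Gamma (of_real b + s * of_real \<beta>)))"
      using lo[OF w] by (intro mult_mono) (auto simp: add.commute)
    finally show ?thesis using 1 by (simp add: C'_def mult_ac)
  qed
  moreover have "C' > 0" using C by (simp add: C'_def)
  ultimately show ?thesis by blast
qed

definition foxH_kernel ::
  "nat \<Rightarrow> nat \<Rightarrow> (nat \<Rightarrow> real) \<Rightarrow> (nat \<Rightarrow> real) \<Rightarrow> (nat \<Rightarrow> real) \<Rightarrow> (nat \<Rightarrow> real) \<Rightarrow> complex \<Rightarrow> complex" where
  "foxH_kernel m p a \<alpha> b \<beta> s =
     foxH_numerator m b \<beta> s / (\<Prod>i=1..p. Gamma (of_real (a i) + s * of_real (\<alpha> i)))"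

text \<open>
  Both directions are kept: the numerator needs the upper bound, the denominator the lower one.
\<close>

lemma prod_Gamma_affine_bounds:
  fixes b \<beta> :: "nat \<Rightarrow> real"
  assumes "\<And>j. j \<in> {1..m} \<Longrightarrow> \<beta> j > 0"
  shows "\<exists>C R. C > 0 \<and> (\<forall>s. Re s > 0 \<longrightarrow> norm s \<ge> R \<longrightarrow>
    norm (\<Prod>j=1..m. Gamma (of_real (b j) + s * of_real (\<beta> j))) \<le> C * exp (\<Sum>j=1..m. stirling_exponent (b j) (\<beta> j) s) \<and>
    exp (\<Sum>j=1..m. stirling_exponent (b j) (\<beta> j) s) \<le> C * norm (\<Prod>j=1..m. Gamma (of_real (b j) + s * of_real (\<beta> j))))"
  using assms
proof (induction m)
  case 0
  show ?case by (rule exI[of _ 1], rule exI[of _ 0]) auto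
next
  case (Suc m)
  define E where "E = (\<lambda>m s. exp (\<Sum>j=1..m. stirling_exponent (b j) (\<beta> j) s))"
  define P where "P = (\<lambda>m s. norm (\<Prod>j=1..m. Gamma (of_real (b j) + s * of_real (\<beta> j) :: complex)))"
  define e where "e = (\<lambda>s. exp (stirling_exponent (b (Suc m)) (\<beta> (Suc m)) s))"
  define g where "g = (\<lambda>s. norm (Gamma (of_real (b (Suc m)) + s * of_real (\<beta> (Suc m)) :: complex)))"
  have "\<exists>C R. C > 0 \<and> (\<forall>s. Re s > 0 \<longrightarrow> norm s \<ge> R \<longrightarrow> P m s \<le> C * E m s \<and> E m s \<le> C * P m s)"
    unfolding P_def E_def using Suc.prems by (intro Suc.IH) auto
  then obtain C R where C: "C > 0"
    and CR: "\<And>s. Re s > 0 \<Longrightarrow> norm s \<ge> R \<Longrightarrow> P m s \<le> C * E m s \<and> E m s \<le> C * P m s"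
    by metis
  have "\<exists>C R. C > 0 \<and> (\<forall>s. Re s > 0 \<longrightarrow> norm s \<ge> R \<longrightarrow> g s \<le> C * e s \<and> e s \<le> C * g s)"
    unfolding g_def e_def using Suc.prems by (intro Gamma_affine_bounds) auto
  then obtain C' R' where C': "C' > 0"
    and CR': "\<And>s. Re s > 0 \<Longrightarrow> norm s \<ge> R' \<Longrightarrow> g s \<le> C' * e s \<and> e s \<le> C' * g s"
    by metis
  have PS: "P (Suc m) s = P m s * g s" and ES: "E (Suc m) s = E m s * e s" for s
    by (simp_all add: P_def g_def E_def e_def norm_mult exp_add)
  have nn: "P m s \<ge> 0" "g s \<ge> 0" "E m s \<ge> 0" "e s \<ge> 0" for s
    by (simp_all add: P_def g_def E_def e_def)
  have "P (Suc m) s \<le> (C * C') * E (Suc m) s \<and> E (Suc m) s \<le> (C * C') * P (Suc m) s"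
    if "Re s > 0" "norm s \<ge> max R R'" for s
  proof -
    have "P m s * g s \<le> (C * E m s) * (C' * e s)"
      using CR[of s] CR'[of s] that nn C C' by (intro mult_mono) auto
    moreover have "E m s * e s \<le> (C * P m s) * (C' * g s)"
      using CR[of s] CR'[of s] that nn C C' by (intro mult_mono) auto
    ultimately show ?thesis unfolding PS ES by (simp add: mult_ac)
  qed
  moreover have "C * C' > 0" using C C' by simp
  ultimately show ?case unfolding P_def E_def by blast
qed

lemma sum_stirling_exponent:
  assumes "\<And>i. i \<in> {1..p} \<Longrightarrow> \<alpha> i > 0" "\<And>j. j \<in> {1..m} \<Longrightarrow> \<beta> j > 0"
  shows "(\<Sum>j=1..m. stirling_exponent (b j) (\<beta> j) s) - (\<Sum>i=1..p. stirling_exponent (a i) (\<alpha> i) s) =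
    foxH_Delta m p \<alpha> \<beta> * (Re (s * Ln s) - Re s) + foxH_mu m p a b * Re (Ln s) +
    ln (foxH_delta m p \<alpha> \<beta>) * Re s"
proof -
  have e: "stirling_exponent b \<beta> s = \<beta> * (Re (s * Ln s) - Re s) + (b - 1/2) * Re (Ln s) + \<beta> * ln \<beta> * Re s"
    for b \<beta> by (simp add: stirling_exponent_def algebra_simps)
  have "ln (\<Prod>j=1..m. \<beta> j powr \<beta> j) = (\<Sum>j=1..m. \<beta> j * ln (\<beta> j))"
    using assms by (subst ln_prod) (force simp: ln_powr intro!: sum.cong)+
  moreover have "ln (\<Prod>i=1..p. \<alpha> i powr (- \<alpha> i)) = - (\<Sum>i=1..p. \<alpha> i * ln (\<alpha> i))"
    using assms by (subst ln_prod) (force simp: ln_powr sum_negf[symmetric] intro!: sum.cong)+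
  moreover have "ln (foxH_delta m p \<alpha> \<beta>) = ln (\<Prod>j=1..m. \<beta> j powr \<beta> j) + ln (\<Prod>i=1..p. \<alpha> i powr (- \<alpha> i))"
    unfolding foxH_delta_def using assms by (intro ln_mult_pos prod_pos) force+
  ultimately have d: "ln (foxH_delta m p \<alpha> \<beta>) = (\<Sum>j=1..m. \<beta> j * ln (\<beta> j)) - (\<Sum>i=1..p. \<alpha> i * ln (\<alpha> i))"
    by simp
  show ?thesis
    unfolding d e sum.distrib sum_subtractf foxH_Delta_def foxH_mu_def sum_distrib_right[symmetric]
    by (simp add: algebra_simps diff_divide_distrib)
qed

lemma foxH_kernel_bound:
  assumes \<alpha>: "\<And>i. i \<in> {1..p} \<Longrightarrow> \<alpha> i > 0" and \<beta>: "\<And>j. j \<in> {1..m} \<Longrightarrow> \<beta> j > 0"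
    and \<Delta>: "foxH_Delta m p \<alpha> \<beta> \<ge> 0"
  obtains C R where "C > 0" "\<And>s. Re s > 0 \<Longrightarrow> norm s \<ge> R \<Longrightarrow> norm (foxH_kernel m p a \<alpha> b \<beta> s) \<le>
    C * exp ((foxH_mu m p a b - foxH_Delta m p \<alpha> \<beta> * Re s) * ln (norm s)
          + 2 * foxH_Delta m p \<alpha> \<beta> * Re s * ln (Re s) - foxH_Delta m p \<alpha> \<beta> * Re s
          + ln (foxH_delta m p \<alpha> \<beta>) * Re s)"
proof -
  define EB where "EB = (\<lambda>s. \<Sum>j=1..m. stirling_exponent (b j) (\<beta> j) s)"
  define EA where "EA = (\<lambda>s. \<Sum>i=1..p. stirling_exponent (a i) (\<alpha> i) s)"
  define PA where "PA = (\<lambda>s::complex. \<Prod>i=1..p. Gamma (of_real (a i) + s * of_real (\<alpha> i)))"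
  define \<Delta>' \<mu> where "\<Delta>' = foxH_Delta m p \<alpha> \<beta>" and "\<mu> = foxH_mu m p a b"
  define \<delta> where "\<delta> = foxH_delta m p \<alpha> \<beta>"
  have "\<exists>C R. C > 0 \<and> (\<forall>s. Re s > 0 \<longrightarrow> norm s \<ge> R \<longrightarrow>
      norm (foxH_numerator m b \<beta> s) \<le> C * exp (EB s) \<and> exp (EB s) \<le> C * norm (foxH_numerator m b \<beta> s))"
    unfolding foxH_numerator_def EB_def by (intro prod_Gamma_affine_bounds \<beta>)
  then obtain C R where C: "C > 0"
    and up: "\<And>s. Re s > 0 \<Longrightarrow> norm s \<ge> R \<Longrightarrow> norm (foxH_numerator m b \<beta> s) \<le> C * exp (EB s)"
    by metis
  have "\<exists>C R. C > 0 \<and> (\<forall>s. Re s > 0 \<longrightarrow> norm s \<ge> R \<longrightarrow>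
      norm (PA s) \<le> C * exp (EA s) \<and> exp (EA s) \<le> C * norm (PA s))"
    unfolding PA_def EA_def by (intro prod_Gamma_affine_bounds \<alpha>)
  then obtain C' R' where C': "C' > 0"
    and lo: "\<And>s. Re s > 0 \<Longrightarrow> norm s \<ge> R' \<Longrightarrow> exp (EA s) \<le> C' * norm (PA s)"
    by metis
  show ?thesis
  proof (rule that[of "C * C'" "max R R'"])
    show "C * C' > 0" using C C' by simp
    fix s assume s: "Re s > 0" "norm s \<ge> max R R'"
    have s0: "s \<noteq> 0" using s by auto
    have PA: "norm (PA s) > 0" "1 / norm (PA s) \<le> C' * exp (- EA s)"
    proof -
      have *: "0 < exp (EA s)" "exp (EA s) \<le> C' * norm (PA s)" using lo[of s] s by auto
      thus pos: "norm (PA s) > 0"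
        using C' by (metis less_le_trans zero_less_mult_pos)
      show "1 / norm (PA s) \<le> C' * exp (- EA s)"
        using * pos by (simp add: exp_minus divide_simps)
    qed
    have "norm (foxH_kernel m p a \<alpha> b \<beta> s) = norm (foxH_numerator m b \<beta> s) * (1 / norm (PA s))"
      by (simp add: foxH_kernel_def PA_def norm_divide)
    also have "\<dots> \<le> (C * exp (EB s)) * (C' * exp (- EA s))"
      using up[of s] s PA C by (intro mult_mono) auto
    also have "\<dots> = C * C' * exp (EB s - EA s)"
      by (simp add: exp_diff exp_minus field_simps)
    also have "EB s - EA s = \<Delta>' * (Re (s * Ln s) - Re s) + \<mu> * Re (Ln s) + ln \<delta> * Re s"
      unfolding EB_def EA_def \<Delta>'_def \<mu>_def \<delta>_def using \<alpha> \<beta> by (rule sum_stirling_exponent)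
    also have "\<dots> \<le> \<Delta>' * ((2 * Re s * ln (Re s) - Re s * ln (norm s)) - Re s) + \<mu> * Re (Ln s) + ln \<delta> * Re s"
      using \<Delta> Re_mult_Ln_le[OF s(1)] unfolding \<Delta>'_def by (intro add_right_mono mult_left_mono diff_right_mono)
    also have "\<dots> = (\<mu> - \<Delta>' * Re s) * ln (norm s) + 2 * \<Delta>' * Re s * ln (Re s) - \<Delta>' * Re s + ln \<delta> * Re s"
      using s0 by (simp add: algebra_simps)
    finally show "norm (foxH_kernel m p a \<alpha> b \<beta> s) \<le>
    C * C' * exp ((foxH_mu m p a b - foxH_Delta m p \<alpha> \<beta> * Re s) * ln (norm s)
          + 2 * foxH_Delta m p \<alpha> \<beta> * Re s * ln (Re s) - foxH_Delta m p \<alpha> \<beta> * Re s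
          + ln (foxH_delta m p \<alpha> \<beta>) * Re s)"
      using C C' unfolding \<Delta>'_def \<mu>_def \<delta>_def by (simp add: mult_left_mono)
  qed
qed

text \<open>
  Translating \<open>s\<close> is a change of the parameters \<open>a\<close> and \<open>b\<close>. Estimates far to the right, valid for all real
  parameters, thereby reach every vertical strip.
\<close>

lemma foxH_kernel_shift:
  "foxH_kernel m p a \<alpha> b \<beta> s =
   foxH_kernel m p (\<lambda>i. a i - A * \<alpha> i) \<alpha> (\<lambda>j. b j - A * \<beta> j) \<beta> (s + of_real A)"
proof -
  have "of_real (b - A * \<beta>) + (s + of_real A) * of_real \<beta> = of_real b + s * of_real \<beta>" for b \<beta>
    by (simp add: algebra_simps)
  thus ?thesis unfolding foxH_kernel_def foxH_numerator_def by (simp only:)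
qed

text \<open>
  After a translation by \<open>A\<close> the parameter \<open>\<mu>\<close> becomes \<open>\<mu> - \<Delta>A\<close>, so the power of \<open>|s|\<close> in the kernel bound can be made
  as negative as desired.
\<close>

lemma foxH_kernel_strip_decay:
  assumes \<alpha>: "\<And>i. i \<in> {1..p} \<Longrightarrow> \<alpha> i > 0" and \<beta>: "\<And>j. j \<in> {1..m} \<Longrightarrow> \<beta> j > 0"
    and \<Delta>: "foxH_Delta m p \<alpha> \<beta> > 0"
  obtains C R where "C > 0" "R \<ge> 1" "\<And>s. Re s \<in> {l..h} \<Longrightarrow> \<bar>Im s\<bar> \<ge> R \<Longrightarrow>
     norm (foxH_kernel m p a \<alpha> b \<beta> s) \<le> C / (Im s)\<^sup>2"
proof -
  define \<Delta>' \<mu> where "\<Delta>' = foxH_Delta m p \<alpha> \<beta>" and "\<mu> = foxH_mu m p a b"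
  define \<delta> where "\<delta> = foxH_delta m p \<alpha> \<beta>"
  \<comment> \<open>the strip lands in \<open>Re s \<ge> 1\<close>, and the power of \<open>|s|\<close> drops to at most \<open>-2\<close>\<close>
  define A where "A = max (1 - l) ((\<mu> + 2) / \<Delta>')"
  define a' b' where "a' = (\<lambda>i. a i - A * \<alpha> i)" and "b' = (\<lambda>j. b j - A * \<beta> j)"
  have A: "A + l \<ge> 1" "\<mu> - \<Delta>' * A \<le> -2"
    using \<Delta> by (auto simp: A_def \<Delta>'_def max_def field_simps split: if_splits)
  have \<mu>': "foxH_mu m p a' b' = \<mu> - \<Delta>' * A"
    unfolding foxH_mu_def \<mu>_def \<Delta>'_def foxH_Delta_def a'_def b'_def
    by (simp add: sum_subtractf sum_distrib_left[symmetric] algebra_simps)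
  obtain C R where C: "C > 0" and CR: "\<And>s. Re s > 0 \<Longrightarrow> norm s \<ge> R \<Longrightarrow>
    norm (foxH_kernel m p a' \<alpha> b' \<beta> s) \<le>
    C * exp ((foxH_mu m p a' b' - \<Delta>' * Re s) * ln (norm s)
          + 2 * \<Delta>' * Re s * ln (Re s) - \<Delta>' * Re s
          + ln \<delta> * Re s)"
    using foxH_kernel_bound[of p \<alpha> m \<beta> a' b'] assms unfolding \<Delta>'_def \<delta>_def
    by (metis less_imp_le)
  define H where "H = A + h"
  define M where "M = 2 * \<Delta>' * (H * ln H) + \<bar>ln \<delta>\<bar> * H"
  show ?thesis
  proof (rule that[of "C * exp M" "max R 1"])
    show "C * exp M > 0" using C by simp
    show "max R 1 \<ge> 1" by simp
    fix s assume s: "Re s \<in> {l..h}" "\<bar>Im s\<bar> \<ge> max R 1"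
    define s' where "s' = s + of_real A"
    define \<sigma> where "\<sigma> = Re s'"
    have \<sigma>: "\<sigma> \<ge> 1" "\<sigma> \<le> H" using s A by (auto simp: \<sigma>_def s'_def H_def)
    have ns: "norm s' \<ge> \<bar>Im s\<bar>" using abs_Im_le_cmod[of s'] by (simp add: s'_def)
    have l0: "ln \<bar>Im s\<bar> \<ge> 0" using s by simp
    have lns: "ln (norm s') \<ge> ln \<bar>Im s\<bar>" using ns s by (subst ln_le_cancel_iff) auto
    have "norm (foxH_kernel m p a \<alpha> b \<beta> s) = norm (foxH_kernel m p a' \<alpha> b' \<beta> s')"
      unfolding a'_def b'_def s'_def by (subst foxH_kernel_shift[of _ _ _ _ _ _ _ A]) simp
    also have "\<dots> \<le> C * exp ((\<mu> - \<Delta>' * A - \<Delta>' * \<sigma>) * ln (norm s') + 2 * \<Delta>' * \<sigma> * ln \<sigma> - \<Delta>' * \<sigma> + ln \<delta> * \<sigma>)"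
      using CR[of s'] \<sigma> s ns unfolding \<mu>' by (auto simp: \<sigma>_def)
    also have "(\<mu> - \<Delta>' * A - \<Delta>' * \<sigma>) * ln (norm s') + 2 * \<Delta>' * \<sigma> * ln \<sigma> - \<Delta>' * \<sigma> + ln \<delta> * \<sigma> \<le>
         -2 * ln \<bar>Im s\<bar> + M"
    proof -
      have "(\<mu> - \<Delta>' * A - \<Delta>' * \<sigma>) * ln (norm s') \<le> -2 * ln (norm s')"
      proof (intro mult_right_mono)
        have "\<Delta>' * \<sigma> \<ge> 0" using \<sigma> \<Delta> by (simp add: \<Delta>'_def)
        thus "\<mu> - \<Delta>' * A - \<Delta>' * \<sigma> \<le> -2" using A(2) by linarith
      qed (use lns l0 in linarith)
      also have "\<dots> \<le> -2 * ln \<bar>Im s\<bar>" using lns by simp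
      finally have 1: "(\<mu> - \<Delta>' * A - \<Delta>' * \<sigma>) * ln (norm s') \<le> -2 * ln \<bar>Im s\<bar>" .
      have "\<sigma> * ln \<sigma> \<le> H * ln H" using \<sigma> by (intro mult_mono) auto
      hence 2: "2 * \<Delta>' * (\<sigma> * ln \<sigma>) \<le> 2 * \<Delta>' * (H * ln H)" using \<Delta> by (simp add: \<Delta>'_def)
      have "ln \<delta> * \<sigma> \<le> \<bar>ln \<delta>\<bar> * H" using \<sigma> by (intro mult_mono) auto
      moreover have "\<Delta>' * \<sigma> \<ge> 0" using \<sigma> \<Delta> by (simp add: \<Delta>'_def)
      ultimately show ?thesis using 1 2 unfolding M_def by (simp add: mult.assoc)
    qed
    also have "exp (-2 * ln \<bar>Im s\<bar> + M) = exp M / (Im s)\<^sup>2"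
    proof -
      have "exp (2 * ln \<bar>Im s\<bar>) = (Im s)\<^sup>2"
      proof -
        have "\<bar>Im s\<bar> > 0" using s by auto
        thus ?thesis by (simp add: exp_double)
      qed
      thus ?thesis by (simp add: exp_diff)
    qed
    finally show "norm (foxH_kernel m p a \<alpha> b \<beta> s) \<le> C * exp M / (Im s)\<^sup>2"
      using C by simp
  qed
qed

section \<open>Integrals along horizontal and vertical lines\<close>

lemma has_bochner_integral_inverse_one_plus_square:
  "has_bochner_integral lborel (\<lambda>t::real. 1 / (1 + t\<^sup>2)) pi"
proof -
  have den: "1 + t\<^sup>2 > 0" for t :: real by (simp add: add_pos_nonneg)
  have "(\<integral>\<^sup>+t. ennreal (1 / (1 + t\<^sup>2)) * indicator {0..} t \<partial>lborel) = ennreal (pi / 2 - arctan 0)"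
    by (rule nn_integral_FTC_atLeast)
       (auto intro!: derivative_eq_intros tendsto_arctan_at_top simp: divide_simps den less_imp_le)
  hence "(\<integral>\<^sup>+t. ennreal (indicator {0..} t *\<^sub>R (1 / (1 + t\<^sup>2))) \<partial>lborel) = ennreal (pi / 2)"
    by (subst (asm) nn_integral_cong[of _ _ "\<lambda>t. ennreal (indicator {0..} t *\<^sub>R (1 / (1 + t\<^sup>2)))"])
       (auto split: split_indicator)
  hence "has_bochner_integral lborel (\<lambda>t::real. indicator {0..} t *\<^sub>R (1 / (1 + t\<^sup>2))) (pi / 2)"
    using den by (intro has_bochner_integral_nn_integral) (auto simp: less_imp_le)
  hence "has_bochner_integral lborel (\<lambda>t::real. 1 / (1 + t\<^sup>2)) (2 *\<^sub>R (pi / 2))"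
    by (rule has_bochner_integral_even_function) auto
  thus ?thesis by simp
qed

lemma has_bochner_integral_inverse_one_plus_scaled_square:
  assumes "k > 0"
  shows "has_bochner_integral lborel (\<lambda>t::real. 1 / (1 + k * t\<^sup>2)) (pi / sqrt k)"
proof -
  have "has_bochner_integral lborel (\<lambda>t::real. 1 / (1 + (0 + sqrt k * t)\<^sup>2)) (pi /\<^sub>R \<bar>sqrt k\<bar>)"
    using has_bochner_integral_inverse_one_plus_square assms
    by (subst lborel_has_bochner_integral_real_affine_iff[symmetric]) auto
  thus ?thesis using assms by (simp add: power_mult_distrib divide_inverse mult.commute)
qed

text \<open>
  Quadratic decay is enough: it makes vertical line integrals converge absolutely and horizontal
  segments of bounded length negligible.
\<close>

definition strip_decay :: "(complex \<Rightarrow> complex) \<Rightarrow> bool" where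
  "strip_decay f \<longleftrightarrow> (\<forall>l h. \<exists>C R. \<forall>s. Re s \<in> {l..h} \<longrightarrow> \<bar>Im s\<bar> \<ge> R \<longrightarrow> norm (f s) \<le> C / (Im s)\<^sup>2)"

lemma strip_decay_integrable:
  assumes cont: "continuous_on UNIV (\<lambda>t. f (Complex c t))" and "strip_decay f"
  shows "integrable lborel (\<lambda>t. f (Complex c t))"
proof -
  obtain C R where CR: "\<And>s. Re s \<in> {c..c} \<Longrightarrow> \<bar>Im s\<bar> \<ge> R \<Longrightarrow> norm (f s) \<le> C / (Im s)\<^sup>2"
    using assms(2) unfolding strip_decay_def by metis
  define R' where "R' = max R 1"
  have den: "1 + t\<^sup>2 > 0" for t :: real by (simp add: add_pos_nonneg)
  have "compact ((\<lambda>t. norm (f (Complex c t)) * (1 + t\<^sup>2)) ` {-R'..R'})"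
    by (intro compact_continuous_image continuous_intros continuous_on_subset[OF cont]) auto
  then obtain B where "\<forall>x \<in> (\<lambda>t. norm (f (Complex c t)) * (1 + t\<^sup>2)) ` {-R'..R'}. norm x \<le> B"
    using compact_imp_bounded bounded_iff by metis
  hence B: "norm (f (Complex c t)) * (1 + t\<^sup>2) \<le> B" if "t \<in> {-R'..R'}" for t
    using that by (fastforce simp: abs_mult)
  have "norm (f (Complex c t)) \<le> (max B (2 * C)) * (1 / (1 + t\<^sup>2))" for t
  proof -
    have "norm (f (Complex c t)) * (1 + t\<^sup>2) \<le> max B (2 * C)"
    proof (cases "t \<in> {-R'..R'}")
      case False
      hence t: "\<bar>t\<bar> \<ge> R" "\<bar>t\<bar> \<ge> 1" by (auto simp: R'_def)
      have t2: "t\<^sup>2 \<ge> 1" using power_mono[OF t(2), of 2] by simp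
      have *: "norm (f (Complex c t)) \<le> C / t\<^sup>2" using CR[of "Complex c t"] t by simp
      have "norm (f (Complex c t)) * (1 + t\<^sup>2) \<le> norm (f (Complex c t)) * (2 * t\<^sup>2)"
        using t2 by (intro mult_left_mono) auto
      also have "\<dots> \<le> 2 * C" using * t pos_le_divide_eq[of "t\<^sup>2" "norm (f (Complex c t))" C] by force
      finally show ?thesis by simp
    qed (use B in fastforce)
    thus ?thesis using den[of t] by (simp add: field_simps)
  qed
  moreover have "integrable lborel (\<lambda>t. (max B (2 * C)) * (1 / (1 + t\<^sup>2)) :: real)"
    using has_bochner_integral_inverse_one_plus_square
    by (intro integrable_mult_right) (auto simp: has_bochner_integral_iff)
  moreover have "(\<lambda>t. f (Complex c t)) \<in> borel_measurable lborel"
    using borel_measurable_continuous_onI[OF cont] by simp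
  moreover have "norm (f (Complex c t)) \<le> norm ((max B (2 * C)) * (1 / (1 + t\<^sup>2)))" for t
    using calculation(1)[of t] unfolding real_norm_def by (rule order.trans[OF _ abs_ge_self])
  ultimately show ?thesis
    by (intro Bochner_Integration.integrable_bound[of lborel "\<lambda>t. max B (2 * C) * (1 / (1 + t\<^sup>2))" "\<lambda>t. f (Complex c t)"] AE_I2)
qed

lemma Complex_line_integrable:
  assumes f: "f holomorphic_on S" and line: "\<And>t. Complex c t \<in> S" and "strip_decay f"
  shows "integrable lborel (\<lambda>t. f (Complex c t))"
proof (rule strip_decay_integrable)
  have "continuous_on UNIV (\<lambda>t. Complex c t)"
    by (simp add: Complex_eq continuous_intros)
  moreover have "range (Complex c) \<subseteq> S" using line by auto
  ultimately show "continuous_on UNIV (\<lambda>t. f (Complex c t))"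
    using holomorphic_on_imp_continuous_on[OF f] by (metis continuous_on_compose2)
qed fact

lemma vertical_integral_limit:
  fixes y1 y2 :: "real \<Rightarrow> real"
  assumes int: "integrable lborel (\<lambda>t. f (Complex c t))"
    and y1: "filterlim y1 at_bot at_top" and y2: "filterlim y2 at_top at_top"
  shows "((\<lambda>T. contour_integral (linepath (Complex c (y1 T)) (Complex c (y2 T))) f)
           \<longlongrightarrow> \<i> * (LINT t|lborel. f (Complex c t))) at_top"
proof -
  let ?g = "\<lambda>t. f (Complex c t)"
  have [measurable]: "?g \<in> borel_measurable lborel" using int by auto
  have "((\<lambda>T. LINT t|lborel. indicator {y1 T..y2 T} t *\<^sub>R ?g t) \<longlongrightarrow> (LINT t|lborel. ?g t)) at_top"
  proof (rule integral_dominated_convergence_at_top[where w = "\<lambda>t. norm (?g t)"])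
    show "AE t in lborel. ((\<lambda>T. indicator {y1 T..y2 T} t *\<^sub>R ?g t) \<longlongrightarrow> ?g t) at_top"
    proof (intro AE_I2 tendsto_eventually)
      fix t :: real
      have "eventually (\<lambda>T. y1 T \<le> t) at_top" "eventually (\<lambda>T. y2 T \<ge> t) at_top"
        using y1 y2 by (auto simp: filterlim_at_bot filterlim_at_top)
      thus "eventually (\<lambda>T. indicator {y1 T..y2 T} t *\<^sub>R ?g t = ?g t) at_top"
        by eventually_elim auto
    qed
  qed (use int in \<open>auto intro!: always_eventually AE_I2 split: split_indicator\<close>)
  hence "((\<lambda>T. \<i> * (LINT t|lborel. indicator {y1 T..y2 T} t *\<^sub>R ?g t)) \<longlongrightarrow> \<i> * (LINT t|lborel. ?g t)) at_top"
    by (intro tendsto_intros)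
  moreover have "eventually (\<lambda>T. y1 T \<le> -1) at_top" "eventually (\<lambda>T. y2 T \<ge> 1) at_top"
    using y1 y2 by (auto simp: filterlim_at_bot filterlim_at_top)
  hence "eventually (\<lambda>T. \<i> * (LINT t|lborel. indicator {y1 T..y2 T} t *\<^sub>R ?g t) =
     contour_integral (linepath (Complex c (y1 T)) (Complex c (y2 T))) f) at_top"
  proof eventually_elim
    case (elim T)
    have "set_integrable lborel {y1 T..y2 T} ?g"
      unfolding set_integrable_def by (intro integrable_mult_indicator int) auto
    hence "(LINT t|lborel. indicator {y1 T..y2 T} t *\<^sub>R ?g t) = integral {y1 T..y2 T} ?g"
      using set_borel_integral_eq_integral(2) unfolding set_lebesgue_integral_def by blast
    thus ?case
      using elim contour_integral_linepath_same_Re[of "Complex c (y1 T)" c "Complex c (y2 T)" "y1 T" "y2 T" f]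
      by simp
  qed
  ultimately show ?thesis by (rule Lim_transform_eventually)
qed

lemma horizontal_integral_vanishes:
  fixes u v :: "'a \<Rightarrow> complex"
  assumes "strip_decay f"
    and im: "\<And>T. Im (u T) = Im (v T)" and inf: "filterlim (\<lambda>T. Im (u T)) at_infinity F"
    and u: "eventually (\<lambda>T. Re (u T) \<in> {l..h}) F" and v: "eventually (\<lambda>T. Re (v T) \<in> {l..h}) F"
    and int: "eventually (\<lambda>T. f contour_integrable_on (linepath (u T) (v T))) F"
  shows "((\<lambda>T. contour_integral (linepath (u T) (v T)) f) \<longlongrightarrow> 0) F"
proof -
  obtain C R where CR: "\<And>s. Re s \<in> {l..h} \<Longrightarrow> \<bar>Im s\<bar> \<ge> R \<Longrightarrow> norm (f s) \<le> C / (Im s)\<^sup>2"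
    using assms(1) unfolding strip_decay_def by metis
  show ?thesis
  proof (rule Lim_null_comparison)
    have "filterlim (\<lambda>T. (Im (u T))\<^sup>2) at_infinity F"
      by (rule filterlim_compose[OF filterlim_power_at_infinity inf]) auto
    thus "((\<lambda>T. \<bar>C\<bar> * (h - l) / (Im (u T))\<^sup>2) \<longlongrightarrow> 0) F"
      by (intro tendsto_divide_0[OF tendsto_const])
    have "eventually (\<lambda>T. \<bar>Im (u T)\<bar> \<ge> R) F"
      using inf unfolding filterlim_at_infinity_conv_norm_at_top filterlim_at_top by simp
    with u v int show "eventually (\<lambda>T. norm (contour_integral (linepath (u T) (v T)) f) \<le> \<bar>C\<bar> * (h - l) / (Im (u T))\<^sup>2) F"
    proof eventually_elim
      case (elim T)
      have uv: "v T - u T = of_real (Re (v T) - Re (u T))" using im[of T] by (simp add: complex_eq_iff)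
      have "norm (contour_integral (linepath (u T) (v T)) f) \<le> \<bar>C\<bar> / (Im (u T))\<^sup>2 * norm (v T - u T)"
      proof (rule contour_integral_bound_linepath)
        fix s assume "s \<in> closed_segment (u T) (v T)"
        hence s: "Im s = Im (u T)" "Re s \<in> {l..h}"
          using closed_segment_same_Im[OF im[of T]] elim by (auto simp: closed_segment_eq_real_ivl split: if_splits)
        hence "norm (f s) \<le> C / (Im s)\<^sup>2" using CR[of s] elim s by simp
        also have "\<dots> \<le> \<bar>C\<bar> / (Im s)\<^sup>2" by (intro divide_right_mono) auto
        finally show "norm (f s) \<le> \<bar>C\<bar> / (Im (u T))\<^sup>2" using s by simp
      qed (use elim in auto)
      also have "\<dots> \<le> \<bar>C\<bar> / (Im (u T))\<^sup>2 * (h - l)"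
        unfolding uv norm_of_real using elim by (intro mult_left_mono) auto
      finally show ?case by simp
    qed
  qed
qed

section \<open>From a contour to a vertical line\<close>

lemma Im_Ln_upper_half_plane:
  assumes "Im w > 0"
  shows "Im (Ln w) = pi / 2 - arctan (Re w / Im w)"
proof -
  define v where "v = - \<i> * w"
  have v: "Re v > 0" "v \<noteq> 0" using assms by (auto simp: v_def)
  have "Im (Ln v) = arctan (Im v / Re v)"
    using arg_conv_arctan[OF v(1)] v by (simp add: Arg_eq_Im_Ln)
  also have "\<dots> = - arctan (Re w / Im w)" by (simp add: v_def arctan_minus flip: minus_divide_left)
  finally have Lv: "Im (Ln v) = - arctan (Re w / Im w)" .
  have "Ln w = Ln (\<i> * v)" by (simp add: v_def flip: mult.assoc)
  also have "\<dots> = Ln \<i> + Ln v"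
    using v Re_Ln_pos_lt_imp[OF v(1)] by (intro Ln_times_simple) auto
  finally show ?thesis using Lv by simp
qed



lemma Im_Ln_tendsto_upwards:
  assumes Re: "((\<lambda>t. Re (g t)) \<longlongrightarrow> r) F" and Im: "filterlim (\<lambda>t. Im (g t)) at_top F"
  shows "((\<lambda>t. Im (Ln (g t))) \<longlongrightarrow> pi / 2) F"
proof -
  have "((\<lambda>t. Re (g t) / Im (g t)) \<longlongrightarrow> 0) F"
    by (rule tendsto_divide_0[OF Re filterlim_at_top_imp_at_infinity[OF Im]])
  hence "((\<lambda>t. pi / 2 - arctan (Re (g t) / Im (g t))) \<longlongrightarrow> pi / 2 - arctan 0) F"
    by (intro tendsto_intros)
  moreover have "eventually (\<lambda>t. pi / 2 - arctan (Re (g t) / Im (g t)) = Im (Ln (g t))) F"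
    using filterlim_at_top_dense[THEN iffD1, OF Im, rule_format, of 0]
    by eventually_elim (simp add: Im_Ln_upper_half_plane)
  ultimately show ?thesis by (auto elim: Lim_transform_eventually)
qed

lemma Im_Ln_tendsto_downwards:
  assumes Re: "((\<lambda>t. Re (g t)) \<longlongrightarrow> r) F" and Im: "filterlim (\<lambda>t. Im (g t)) at_bot F"
  shows "((\<lambda>t. Im (Ln (g t))) \<longlongrightarrow> - pi / 2) F"
proof -
  have "((\<lambda>t. - Im (Ln (cnj (g t)))) \<longlongrightarrow> - (pi / 2)) F"
    using Re Im by (intro tendsto_minus Im_Ln_tendsto_upwards[where r = r])
      (auto simp: filterlim_uminus_at_top)
  moreover have "eventually (\<lambda>t. - Im (Ln (cnj (g t))) = Im (Ln (g t))) F"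
    using filterlim_at_bot_dense[THEN iffD1, OF Im, rule_format, of 0]
  proof eventually_elim
    case (elim t)
    hence "cnj (Ln (g t)) = Ln (cnj (g t))"
      by (intro cnj_Ln) (auto simp: complex_nonpos_Reals_iff)
    thus ?case by (metis add.inverse_inverse cnj.sel(2))
  qed
  ultimately show ?thesis by (auto elim: Lim_transform_eventually)
qed

lemma winding_number_slit_plane:
  assumes "valid_path g" and slit: "\<And>w. w \<in> path_image g \<Longrightarrow> w - z \<notin> \<real>\<^sub>\<le>\<^sub>0"
  shows "winding_number g z = (Ln (pathfinish g - z) - Ln (pathstart g - z)) / (2 * of_real pi * \<i>)"
proof -
  have z: "z \<notin> path_image g" using slit by fastforce
  have "((\<lambda>w. 1 / (w - z)) has_contour_integral (Ln (pathfinish g - z) - Ln (pathstart g - z))) g"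
    using assms
    by (intro contour_integral_primitive[where S = "path_image g" and f = "\<lambda>w. Ln (w - z)"])
       (auto intro!: derivative_eq_intros simp: inverse_eq_divide)
  thus ?thesis
    using winding_number_valid_path[OF assms(1) z] by (simp add: contour_integral_unique)
qed

text \<open>
  Passes from \<open>u\<close> to \<open>v\<close> through the line \<open>Re s = c\<close>. When \<open>u\<close> lies above and \<open>v\<close> below the real axis, the real axis is
  crossed only at \<open>c\<close>, so the slit to the left of any real \<open>z < c\<close> is avoided.
\<close>

definition right_detour :: "real \<Rightarrow> complex \<Rightarrow> complex \<Rightarrow> real \<Rightarrow> complex" where
  "right_detour c u v = linepath u (Complex c (Im u)) +++
     (linepath (Complex c (Im u)) (Complex c (Im v)) +++ linepath (Complex c (Im v)) v)"

lemma right_detour_path [simp]: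
  "valid_path (right_detour c u v)" "pathstart (right_detour c u v) = u" "pathfinish (right_detour c u v) = v"
  by (simp_all add: right_detour_def)

lemma right_detour_image:
  assumes "Im u > 0" "Im v < 0"
    and "w \<in> path_image (right_detour c u v)"
  shows "Im w \<noteq> 0 \<or> Re w = c"
  using assms by (auto simp: right_detour_def path_image_join closed_segment_same_Im closed_segment_same_Re)

lemma valid_path_subpath_nested:
  fixes L :: "real \<Rightarrow> complex"
  assumes "valid_path (subpath (- T) T L)" "T > 0" "x \<in> {-T..T}" "y \<in> {-T..T}"
  shows "valid_path (subpath x y L)"
proof -
  define s where "s = (\<lambda>x. (x + T) / (2 * T))"
  have s: "s x \<in> {0..1}" "s y \<in> {0..1}"
    using assms by (auto simp: s_def divide_simps)
  have "subpath (s x) (s y) (subpath (- T) T L) = subpath x y L"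
    using assms(2) by (auto simp: subpath_def s_def fun_eq_iff field_simps intro!: arg_cong[of _ _ L])
  thus ?thesis using valid_path_subpath[OF assms(1) s] by simp
qed

lemma winding_number_subpath_nested:
  fixes L :: "real \<Rightarrow> complex"
  assumes "valid_path (subpath (- T) T L)" "z \<notin> range L" "0 < T0" "T0 \<le> T"
  shows "winding_number (subpath (- T) T L) z =
    winding_number (subpath (- T) (- T0) L) z + winding_number (subpath (- T0) T0 L) z + winding_number (subpath T0 T L) z"
proof -
  have T: "T > 0" using assms by linarith
  define g where "g = subpath (- T) T L"
  define s where "s = (\<lambda>x. (x + T) / (2 * T))"
  have s: "s x \<in> {0..1}" if "x \<in> {-T..T}" for x
    using that T by (auto simp: s_def divide_simps)
  have sub: "subpath (s x) (s y) g = subpath x y L" for x y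
    using T by (auto simp: g_def subpath_def s_def fun_eq_iff field_simps intro!: arg_cong[of _ _ L])
  have g: "path g" "z \<notin> path_image g"
    using assms(1,2) by (auto simp: g_def valid_path_imp_path path_image_subpath_gen)
  have "winding_number (subpath x y L) z + winding_number (subpath y w L) z = winding_number (subpath x w L) z"
    if "x \<in> {-T..T}" "y \<in> {-T..T}" "w \<in> {-T..T}" for x y w
    using winding_number_subpath_combine[OF g s[OF that(1)] s[OF that(2)] s[OF that(3)]] by (simp only: sub)
  from this[of "-T" "-T0" T0] this[of "-T" T0 T] show ?thesis using assms(3,4) by simp
qed

text \<open>
  Beyond \<open>T0\<close> the contour and the detour both avoid the slit to the left of \<open>z\<close>, where winding numbers are differences of
  \<open>Ln\<close>. Hence the total does not depend on \<open>T\<close>. In the limit the contour contributes \<open>1/2\<close> to the real part, by the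
  definition of lying to the left, and the detour \<open>-1/2\<close>, as the argument falls from \<open>\<pi>/2\<close> to \<open>-\<pi>/2\<close>.
  Working with a \<open>T0\<close> that serves all \<open>z\<close> is what allows infinitely many poles.
\<close>

lemma closed_up_contour_winding_zero:
  assumes L: "vertical_contour \<gamma> L" and left: "left_of_contour L z" and z: "Im z = 0" "Re z < c"
    and T0: "T0 > 0" "\<And>t. t \<ge> T0 \<Longrightarrow> Im (L t) > 0" "\<And>t. t \<le> - T0 \<Longrightarrow> Im (L t) < 0"
    and "T \<ge> T0"
  shows "winding_number (subpath (- T) T L +++ right_detour c (L T) (L (- T))) z = 0"
proof -
  define W where "W = (\<lambda>T. subpath (- T) T L +++ right_detour c (L T) (L (- T)))"
  have vp: "valid_path (subpath (- T) T L)" if "T > 0" for T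
    using L that by (simp add: vertical_contour_def)
  have zL: "z \<notin> range L" using left by (simp add: left_of_contour_def)
  define D where "D = 2 * of_real pi * \<i>"
  have D: "D \<noteq> 0" by (simp add: D_def)
  have slit: "w - z \<notin> \<real>\<^sub>\<le>\<^sub>0" if "Im w \<noteq> 0 \<or> Re w = c" for w
    using that z by (auto simp: complex_nonpos_Reals_iff)
  have detour: "winding_number (right_detour c (L T) (L (- T))) z = (Ln (L (- T) - z) - Ln (L T - z)) / D"
     and detour_z: "z \<notin> path_image (right_detour c (L T) (L (- T)))"
     if "T \<ge> T0" for T
  proof -
    have im: "w - z \<notin> \<real>\<^sub>\<le>\<^sub>0" if "w \<in> path_image (right_detour c (L T) (L (- T)))" for w
      using right_detour_image[OF _ _ that] T0 \<open>T \<ge> T0\<close> by (intro slit) auto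
    show "winding_number (right_detour c (L T) (L (- T))) z = (Ln (L (- T) - z) - Ln (L T - z)) / D"
      using winding_number_slit_plane[OF _ im] by (simp add: D_def)
    show "z \<notin> path_image (right_detour c (L T) (L (- T)))" using im[of z] by auto
  qed
  have join: "winding_number (W T) z = winding_number (subpath (- T) T L) z + (Ln (L (- T) - z) - Ln (L T - z)) / D"
     and W_path: "valid_path (W T)" "pathfinish (W T) = pathstart (W T)" "z \<notin> path_image (W T)"
     if "T \<ge> T0" for T
  proof -
    have vpT: "valid_path (subpath (- T) T L)" using vp that T0 by simp
    have zT: "z \<notin> path_image (subpath (- T) T L)" using zL by (auto simp: path_image_subpath_gen)
    show "winding_number (W T) z = winding_number (subpath (- T) T L) z + (Ln (L (- T) - z) - Ln (L T - z)) / D"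
      unfolding W_def using vpT zT detour_z[OF that] that
      by (subst winding_number_join) (auto simp: valid_path_imp_path detour)
    show "valid_path (W T)" "pathfinish (W T) = pathstart (W T)" "z \<notin> path_image (W T)"
      unfolding W_def using vpT zT detour_z[OF that] by (auto simp: path_image_join)
  qed
  have const: "winding_number (W T) z = winding_number (W T0) z" if T: "T \<ge> T0" for T
  proof -
    have sub: "valid_path (subpath x y L)" if "x \<in> {-T..T}" "y \<in> {-T..T}" for x y
      using T T0 that by (intro valid_path_subpath_nested[OF vp]) auto
    have "winding_number (subpath T0 T L) z = (Ln (L T - z) - Ln (L T0 - z)) / D"
    proof -
      have "w - z \<notin> \<real>\<^sub>\<le>\<^sub>0" if "w \<in> path_image (subpath T0 T L)" for w
        using that T T0(2) by (intro slit) (force simp: path_image_subpath)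
      thus ?thesis using winding_number_slit_plane[OF sub, of T0 T z] T T0 by (simp add: D_def)
    qed
    moreover have "winding_number (subpath (- T) (- T0) L) z = (Ln (L (- T0) - z) - Ln (L (- T) - z)) / D"
    proof -
      have "w - z \<notin> \<real>\<^sub>\<le>\<^sub>0" if "w \<in> path_image (subpath (- T) (- T0) L)" for w
        using that T T0(3) by (intro slit) (force simp: path_image_subpath)
      thus ?thesis using winding_number_slit_plane[OF sub, of "- T" "- T0" z] T T0 by (simp add: D_def)
    qed
    ultimately show ?thesis
      using winding_number_subpath_nested[OF vp zL T0(1) T] T T0 join[OF T] join[of T0]
      by (simp add: diff_divide_distrib)
  qed
  have lim: "((\<lambda>T. Re (winding_number (subpath (- T) T L) z) + (Im (Ln (L (- T) - z)) - Im (Ln (L T - z))) / (2 * pi))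
      \<longlongrightarrow> 1 / 2 + (- pi / 2 - pi / 2) / (2 * pi)) at_top"
  proof (intro tendsto_intros)
    show "((\<lambda>T. Re (winding_number (subpath (- T) T L) z)) \<longlongrightarrow> 1 / 2) at_top"
      using left by (simp add: left_of_contour_def)
    show "((\<lambda>T. Im (Ln (L T - z))) \<longlongrightarrow> pi / 2) at_top"
      using L z unfolding vertical_contour_def
      by (intro Im_Ln_tendsto_upwards[where r = "\<gamma> - Re z"]) (auto intro!: tendsto_intros)
    show "((\<lambda>T. Im (Ln (L (- T) - z))) \<longlongrightarrow> - pi / 2) at_top"
    proof (rule Im_Ln_tendsto_downwards[where r = "\<gamma> - Re z"])
      have "((\<lambda>t. Re (L t)) \<longlongrightarrow> \<gamma>) at_bot" "filterlim (\<lambda>t. Im (L t)) at_bot at_bot"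
        using L by (auto simp: vertical_contour_def)
      from this[THEN filterlim_compose, OF filterlim_uminus_at_bot_at_top]
      show "((\<lambda>T. Re (L (- T) - z)) \<longlongrightarrow> \<gamma> - Re z) at_top" "filterlim (\<lambda>T. Im (L (- T) - z)) at_bot at_top"
        using z by (auto intro!: tendsto_intros)
    qed
  qed simp
  have "((\<lambda>T::real. Re (winding_number (W T0) z)) \<longlongrightarrow> 0) at_top"
  proof (rule Lim_transform_eventually)
    show "((\<lambda>T. Re (winding_number (subpath (- T) T L) z) + (Im (Ln (L (- T) - z)) - Im (Ln (L T - z))) / (2 * pi)) \<longlongrightarrow> 0) at_top"
      using lim by (simp add: field_simps)
    show "eventually (\<lambda>T. Re (winding_number (subpath (- T) T L) z) + (Im (Ln (L (- T) - z)) - Im (Ln (L T - z))) / (2 * pi)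
            = Re (winding_number (W T0) z)) at_top"
      using eventually_ge_at_top[of T0]
    proof eventually_elim
      case (elim T)
      have "Re (X / D) = Im X / (2 * pi)" for X
        by (simp add: D_def Re_divide power2_eq_square)
      thus ?case using join[OF elim] const[OF elim] by (metis minus_complex.sel(2) plus_complex.sel(1))
    qed
  qed
  hence "Re (winding_number (W T0) z) = 0" using tendsto_const_iff[of "at_top :: real filter"] by auto
  moreover have "winding_number (W T0) z \<in> \<int>"
    using W_path[of T0] by (intro integer_winding_number valid_path_imp_path) auto
  ultimately have "winding_number (W T0) z = 0" by (auto elim!: Ints_cases)
  thus ?thesis using const[OF \<open>T \<ge> T0\<close>] by (simp add: W_def)
qed

lemma contour_integral_tendsto_vertical_line:
  assumes L: "vertical_contour \<gamma> L" and f: "f holomorphic_on - P" and P: "open (- P)"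
    and left: "\<And>z. z \<in> P \<Longrightarrow> left_of_contour L z" "\<And>z. z \<in> P \<Longrightarrow> Im z = 0 \<and> Re z < c"
    and decay: "strip_decay f"
  shows "((\<lambda>T. contour_integral (subpath (- T) T L) f) \<longlongrightarrow> \<i> * (LINT t|lborel. f (Complex c t))) at_top"
proof -
  have Im1: "filterlim (\<lambda>t. Im (L t)) at_top at_top" "((\<lambda>t. Re (L t)) \<longlongrightarrow> \<gamma>) at_top"
    using L by (auto simp: vertical_contour_def)
  have Im2': "filterlim (\<lambda>t. Im (L t)) at_bot at_bot" "((\<lambda>t. Re (L t)) \<longlongrightarrow> \<gamma>) at_bot"
    using L by (auto simp: vertical_contour_def)
  note Im2 = Im2'[THEN filterlim_compose, OF filterlim_uminus_at_bot_at_top]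
  have "eventually (\<lambda>t. Im (L t) > 0) at_top" using Im1 by (auto simp: filterlim_at_top_dense)
  then obtain t1 where t1: "\<And>t. t \<ge> t1 \<Longrightarrow> Im (L t) > 0" by (auto simp: eventually_at_top_linorder)
  have "eventually (\<lambda>t. Im (L t) < 0) at_bot" using Im2' by (auto simp: filterlim_at_bot_dense)
  then obtain t2 where t2: "\<And>t. t \<le> t2 \<Longrightarrow> Im (L t) < 0" by (auto simp: eventually_at_bot_linorder)
  define T0 where "T0 = max 1 (max t1 (- t2))"
  have T0: "T0 > 0" "\<And>t. t \<ge> T0 \<Longrightarrow> Im (L t) > 0" "\<And>t. t \<le> - T0 \<Longrightarrow> Im (L t) < 0"
    using t1 t2 by (auto simp: T0_def)
  have notP: "w \<notin> P" if "Im w \<noteq> 0 \<or> Re w = c" for w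
    using that left(2)[of w] by auto
  define u where "u = (\<lambda>T. Complex c (Im (L T)))"
  define v where "v = (\<lambda>T. Complex c (Im (L (- T))))"
  define H1 where "H1 = (\<lambda>T. contour_integral (linepath (L T) (u T)) f)"
  define V where "V = (\<lambda>T. contour_integral (linepath (v T) (u T)) f)"
  define H2 where "H2 = (\<lambda>T. contour_integral (linepath (v T) (L (- T))) f)"
  have int: "f contour_integrable_on linepath (L T) (u T)" "f contour_integrable_on linepath (v T) (L (- T))"
            "f contour_integrable_on linepath (u T) (v T)"
            "contour_integral (subpath (- T) T L) f = V T - H1 T - H2 T"
    if T: "T \<ge> T0" for T
  proof -
    have im: "path_image (right_detour c (L T) (L (- T))) \<subseteq> - P"
      using right_detour_image[of "L T" "L (- T)" _ c] T T0 notP by (metis ComplI minus_le_iff neg_le_iff_le subsetI)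
    hence segs: "closed_segment (L T) (u T) \<subseteq> - P" "closed_segment (u T) (v T) \<subseteq> - P" "closed_segment (v T) (L (- T)) \<subseteq> - P"
      by (auto simp: right_detour_def path_image_join u_def v_def)
    have int_line: "f contour_integrable_on linepath x y" if "closed_segment x y \<subseteq> - P" for x y
      using that by (intro contour_integrable_holomorphic_simple[OF f P]) auto
    show i: "f contour_integrable_on linepath (L T) (u T)" "f contour_integrable_on linepath (v T) (L (- T))"
       "f contour_integrable_on linepath (u T) (v T)"
      by (intro int_line segs)+
    have vp: "valid_path (subpath (- T) T L)" using L T T0 by (auto simp: vertical_contour_def)
    have sub: "path_image (subpath (- T) T L) \<subseteq> - P"
      using left(1) by (auto simp: path_image_subpath_gen left_of_contour_def)
    have iL: "f contour_integrable_on subpath (- T) T L"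
      using vp sub by (intro contour_integrable_holomorphic_simple[OF f P])
    let ?W = "subpath (- T) T L +++ right_detour c (L T) (L (- T))"
    have "(f has_contour_integral 0) ?W"
    proof (rule Cauchy_theorem_global[OF P f])
      show "valid_path ?W" "pathfinish ?W = pathstart ?W" using vp by auto
      show "path_image ?W \<subseteq> - P" using sub im by (auto simp: path_image_join)
      fix z assume "z \<notin> - P"
      thus "winding_number ?W z = 0"
        using left[of z] T T0 by (intro closed_up_contour_winding_zero[OF L]) auto
    qed
    hence "contour_integral ?W f = 0" by (rule contour_integral_unique)
    also have "contour_integral ?W f = contour_integral (subpath (- T) T L) f +
        (H1 T + (contour_integral (linepath (u T) (v T)) f + H2 T))"
      unfolding right_detour_def H1_def H2_def using vp iL i by (simp add: u_def v_def)
    also have "contour_integral (linepath (u T) (v T)) f = - V T"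
      unfolding V_def using contour_integral_reversepath[of "linepath (v T) (u T)" f] by simp
    finally show "contour_integral (subpath (- T) T L) f = V T - H1 T - H2 T"
      by (simp add: algebra_simps eq_neg_iff_add_eq_0)
  qed
  have evT: "eventually (\<lambda>T. T \<ge> T0) at_top" by (rule eventually_ge_at_top)
  define l h where "l = min c \<gamma> - 1" and "h = max c \<gamma> + 1"
  have evL: "eventually (\<lambda>T. Re (g T) \<in> {l..h}) at_top" if "((\<lambda>T. Re (g T)) \<longlongrightarrow> \<gamma>) at_top" for g :: "real \<Rightarrow> complex"
    using tendstoD[OF that, of 1] by (simp add: dist_real_def, elim eventually_mono) (auto simp: l_def h_def)
  have c: "c \<in> {l..h}" by (auto simp: l_def h_def)
  have "integrable lborel (\<lambda>t. f (Complex c t))"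
    using notP by (intro Complex_line_integrable[OF f _ decay]) simp
  hence "(V \<longlongrightarrow> \<i> * (LINT t|lborel. f (Complex c t))) at_top"
    unfolding V_def u_def v_def using Im1 Im2 by (intro vertical_integral_limit)
  moreover have "(H1 \<longlongrightarrow> 0) at_top"
    unfolding H1_def using Im1 evL[OF Im1(2)] c
    by (intro horizontal_integral_vanishes[OF decay, where l = l and h = h] eventually_mono[OF evT int(1)])
       (auto simp: u_def filterlim_at_top_imp_at_infinity)
  moreover have "(H2 \<longlongrightarrow> 0) at_top"
    unfolding H2_def using Im2 evL[OF Im2(2)] c
    by (intro horizontal_integral_vanishes[OF decay, where l = l and h = h] eventually_mono[OF evT int(2)])
       (auto simp: v_def filterlim_at_bot_imp_at_infinity)
  ultimately have "((\<lambda>T. V T - H1 T - H2 T) \<longlongrightarrow> \<i> * (LINT t|lborel. f (Complex c t)) - 0 - 0) at_top"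
    by (intro tendsto_diff)
  hence "((\<lambda>T. V T - H1 T - H2 T) \<longlongrightarrow> \<i> * (LINT t|lborel. f (Complex c t))) at_top" by simp
  thus ?thesis
    by (rule Lim_transform_eventually) (use int(4) in \<open>auto intro: eventually_mono[OF evT]\<close>)
qed

section \<open>Crossing a simple pole\<close>

text \<open>
  Cauchy's integral formula for \<open>G\<close> on rectangles between the two lines; \<open>G z\<close> is the residue of \<open>f\<close>.
\<close>

lemma shift_line_past_simple_pole:
  assumes G: "G holomorphic_on {s. Re s > l}" and lc: "l < c'" "c' < Re z" "Re z < c" and z: "Im z = 0"
    and f: "\<And>w. Re w > l \<Longrightarrow> w \<noteq> z \<Longrightarrow> f w = G w / (w - z)"
    and decay: "strip_decay f"
  shows "(LINT t|lborel. f (Complex c t)) = (LINT t|lborel. f (Complex c' t)) + 2 * of_real pi * G z"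
proof -
  define S where "S = {s. Re s > l}"
  have S: "convex S" "open S" unfolding S_def by (rule convex_halfspace_Re_gt open_halfspace_Re_gt)+
  have "(\<lambda>w. G w / (w - z)) holomorphic_on S - {z}"
    using G by (auto simp: S_def intro!: holomorphic_intros elim: holomorphic_on_subset)
  hence fh: "f holomorphic_on S - {z}"
    by (rule holomorphic_transform) (auto simp: f S_def)
  have opz: "open (S - {z})" using S by auto
  have int: "integrable lborel (\<lambda>t. f (Complex d t))" if "d \<in> {c', c}" for d
    using that lc by (intro Complex_line_integrable[OF fh _ decay]) (auto simp: S_def)
  have V: "((\<lambda>T. contour_integral (linepath (Complex d (- T)) (Complex d T)) f)
           \<longlongrightarrow> \<i> * (LINT t|lborel. f (Complex d t))) at_top" if "d \<in> {c', c}" for d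
    using int[OF that] by (rule vertical_integral_limit[OF _ filterlim_uminus_at_bot_at_top filterlim_ident])
  have line: "f contour_integrable_on linepath u v" if "closed_segment u v \<subseteq> S - {z}" for u v
    using that by (intro contour_integrable_holomorphic_simple[OF fh opz]) auto
  have ints: "f contour_integrable_on linepath (Complex c' y) (Complex c y)"
             "f contour_integrable_on linepath (Complex c y) (Complex c' y)" if "y \<noteq> 0" for y
    using that lc z by (auto intro!: line simp: closed_segment_same_Im S_def closed_segment_eq_real_ivl)
  have intsv: "f contour_integrable_on linepath (Complex d y) (Complex d y')" if "d \<in> {c', c}" for y y' d
    using that lc z by (auto intro!: line simp: closed_segment_same_Re S_def)
  define B where "B = (\<lambda>T. contour_integral (linepath (Complex c' (- T)) (Complex c (- T))) f)"
  define U where "U = (\<lambda>T. contour_integral (linepath (Complex c T) (Complex c' T)) f)"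
  have evpos: "eventually (\<lambda>T::real. T > 0) at_top" by (rule eventually_gt_at_top)
  have "(B \<longlongrightarrow> 0) at_top" unfolding B_def
    using lc ints eventually_mono[OF evpos, of "\<lambda>T. f contour_integrable_on linepath (Complex c' (- T)) (Complex c (- T))"]
    by (intro horizontal_integral_vanishes[OF decay, where l = c' and h = c])
       (auto intro: filterlim_at_bot_imp_at_infinity filterlim_uminus_at_bot_at_top)
  moreover have "(U \<longlongrightarrow> 0) at_top" unfolding U_def
    using lc ints eventually_mono[OF evpos, of "\<lambda>T. f contour_integrable_on linepath (Complex c T) (Complex c' T)"]
    by (intro horizontal_integral_vanishes[OF decay, where l = c' and h = c])
       (auto intro: filterlim_at_top_imp_at_infinity filterlim_ident)
  ultimately have "((\<lambda>T. B T + contour_integral (linepath (Complex c (- T)) (Complex c T)) f + U T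
       - contour_integral (linepath (Complex c' (- T)) (Complex c' T)) f)
      \<longlongrightarrow> 0 + \<i> * (LINT t|lborel. f (Complex c t)) + 0 - \<i> * (LINT t|lborel. f (Complex c' t))) at_top"
    by (intro tendsto_intros V) auto
  moreover have "eventually (\<lambda>T. B T + contour_integral (linepath (Complex c (- T)) (Complex c T)) f + U T
       - contour_integral (linepath (Complex c' (- T)) (Complex c' T)) f = 2 * of_real pi * \<i> * G z) at_top"
    using evpos
  proof eventually_elim
    case (elim T)
    let ?R = "rectpath (Complex c' (- T)) (Complex c T)"
    have im: "path_image ?R \<subseteq> S - {z}"
      using elim lc z by (auto simp: path_image_rectpath S_def)
    have w: "winding_number ?R z = 1"
      using elim lc z by (intro winding_number_rectpath) (auto simp: in_box_complex_iff)
    have "((\<lambda>w. G w / (w - z)) has_contour_integral (2 * pi * \<i> * winding_number ?R z * G z)) ?R"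
      using G im lc S by (intro Cauchy_integral_formula_convex_simple[of S]) (auto simp: S_def interior_open)
    hence "(f has_contour_integral (2 * pi * \<i> * winding_number ?R z * G z)) ?R"
    proof (rule has_contour_integral_eq)
      fix w assume "w \<in> path_image ?R"
      hence "w \<in> S - {z}" using im by blast
      thus "G w / (w - z) = f w" using f by (simp add: S_def)
    qed
    hence "2 * of_real pi * \<i> * G z = contour_integral ?R f"
      using w by (simp add: contour_integral_unique)
    also have "\<dots> = B T + (contour_integral (linepath (Complex c (- T)) (Complex c T)) f + (U T
       + contour_integral (linepath (Complex c' T) (Complex c' (- T))) f))"
      unfolding rectpath_def B_def U_def Let_def using ints[of T] ints[of "-T"] intsv elim by simp
    also have "contour_integral (linepath (Complex c' T) (Complex c' (- T))) f =
               - contour_integral (linepath (Complex c' (- T)) (Complex c' T)) f"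
      using contour_integral_reversepath[of "linepath (Complex c' (- T)) (Complex c' T)" f] by simp
    finally show ?case by (simp add: algebra_simps)
  qed
  ultimately have "((\<lambda>T::real. 2 * of_real pi * \<i> * G z) \<longlongrightarrow>
      0 + \<i> * (LINT t|lborel. f (Complex c t)) + 0 - \<i> * (LINT t|lborel. f (Complex c' t))) at_top"
    by (rule Lim_transform_eventually)
  hence "2 * of_real pi * \<i> * G z = \<i> * (LINT t|lborel. f (Complex c t)) - \<i> * (LINT t|lborel. f (Complex c' t))"
    by (simp add: tendsto_const_iff)
  hence "\<i> * (LINT t|lborel. f (Complex c t)) = \<i> * ((LINT t|lborel. f (Complex c' t)) + 2 * of_real pi * G z)"
    by (simp add: algebra_simps)
  thus ?thesis by (subst (asm) mult_cancel_left) auto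
qed

section \<open>The Fox \<open>H\<close>-function as a vertical line integral\<close>

definition foxH_poles :: "nat \<Rightarrow> (nat \<Rightarrow> real) \<Rightarrow> (nat \<Rightarrow> real) \<Rightarrow> complex set" where
  "foxH_poles m b \<beta> = {s. \<exists>j\<in>{1..m}. of_real (b j) + s * of_real (\<beta> j) \<in> \<int>\<^sub>\<le>\<^sub>0}"

lemma foxH_polesE:
  assumes "z \<in> foxH_poles m b \<beta>" "\<And>j. j \<in> {1..m} \<Longrightarrow> \<beta> j > 0"
  obtains j l where "j \<in> {1..m}" "z = foxH_pole b \<beta> j l"
proof -
  obtain j where j: "j \<in> {1..m}" "of_real (b j) + z * of_real (\<beta> j) \<in> \<int>\<^sub>\<le>\<^sub>0"
    using assms(1) by (auto simp: foxH_poles_def)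
  then obtain l :: nat where l: "of_real (b j) + z * of_real (\<beta> j) = - of_nat l"
    by (auto elim!: nonpos_Ints_cases')
  have "complex_of_real (\<beta> j) \<noteq> 0" using assms(2)[OF j(1)] by simp
  hence "z = foxH_pole b \<beta> j l"
    using l by (simp add: foxH_pole_def divide_simps) (simp add: algebra_simps eq_neg_iff_add_eq_0)
  thus ?thesis using that j by blast
qed

lemma open_compl_foxH_poles: "open (- foxH_poles m b \<beta>)"
proof -
  have "- foxH_poles m b \<beta> = (\<Inter>j\<in>{1..m}. (\<lambda>s. of_real (b j) + s * of_real (\<beta> j)) -` (- \<int>\<^sub>\<le>\<^sub>0))"
    by (auto simp: foxH_poles_def)
  also have "open \<dots>"
    by (intro open_INT finite_atLeastAtMost ballI open_vimage continuous_intros) (auto simp: open_Compl)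
  finally show ?thesis .
qed

text \<open>
  With \<open>rGamma\<close> entire, the denominator creates no singularities at the poles of its factors.
\<close>

lemma foxH_kernel_altdef:
  "foxH_kernel m p a \<alpha> b \<beta> s =
    foxH_numerator m b \<beta> s * (\<Prod>i=1..p. rGamma (of_real (a i) + s * of_real (\<alpha> i)))"
  by (simp add: foxH_kernel_def rGamma_inverse_Gamma divide_inverse o_def flip: prod_inversef)

lemma foxH_integrand_altdef:
  "foxH_integrand m p a \<alpha> b \<beta> x s = foxH_kernel m p a \<alpha> b \<beta> s * complex_of_real x powr (- s)"
  by (simp add: foxH_integrand_def foxH_kernel_def)

lemma norm_foxH_integrand:
  "x > 0 \<Longrightarrow> norm (foxH_integrand m p a \<alpha> b \<beta> x s) = norm (foxH_kernel m p a \<alpha> b \<beta> s) * x powr (- Re s)"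
  by (simp add: foxH_integrand_altdef norm_mult norm_powr_real_powr)

lemma holomorphic_foxH_integrand:
  "foxH_integrand m p a \<alpha> b \<beta> x holomorphic_on - foxH_poles m b \<beta>"
  unfolding foxH_integrand_altdef[abs_def] foxH_kernel_altdef foxH_numerator_def
  by (intro holomorphic_intros) (auto simp: foxH_poles_def)

lemma strip_decay_foxH_integrand:
  assumes \<alpha>: "\<And>i. i \<in> {1..p} \<Longrightarrow> \<alpha> i > 0" and \<beta>: "\<And>j. j \<in> {1..m} \<Longrightarrow> \<beta> j > 0"
    and \<Delta>: "foxH_Delta m p \<alpha> \<beta> > 0" and x: "x > 0"
  shows "strip_decay (foxH_integrand m p a \<alpha> b \<beta> x)"
  unfolding strip_decay_def
proof (intro allI)
  fix l h :: real
  obtain C R where C: "C > 0" "R \<ge> 1" and CR: "\<And>s. Re s \<in> {l..h} \<Longrightarrow> \<bar>Im s\<bar> \<ge> R \<Longrightarrow>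
     norm (foxH_kernel m p a \<alpha> b \<beta> s) \<le> C / (Im s)\<^sup>2"
    using foxH_kernel_strip_decay[OF \<alpha> \<beta> \<Delta>, where l = l and h = h and a = a and b = b] by metis
  define M where "M = x powr (- l) + x powr (- h)"
  have "norm (foxH_integrand m p a \<alpha> b \<beta> x s) \<le> (C * M) / (Im s)\<^sup>2" if s: "Re s \<in> {l..h}" "\<bar>Im s\<bar> \<ge> R" for s
  proof -
    have "x powr (- Re s) \<le> M"
    proof (cases "x \<ge> 1")
      case True
      hence "x powr (- Re s) \<le> x powr (- l)" using s by (intro powr_mono) auto
      thus ?thesis unfolding M_def by (rule add_increasing2[rotated]) auto
    next
      case False
      hence "x powr (- Re s) \<le> x powr (- h)" using s x by (intro powr_mono') auto
      thus ?thesis unfolding M_def by (rule add_increasing[rotated]) auto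
    qed
    hence "norm (foxH_kernel m p a \<alpha> b \<beta> s) * x powr (- Re s) \<le> (C / (Im s)\<^sup>2) * M"
      using CR[OF s] C by (intro mult_mono) auto
    thus ?thesis using x by (simp add: norm_foxH_integrand)
  qed
  thus "\<exists>C R. \<forall>s. Re s \<in> {l..h} \<longrightarrow> \<bar>Im s\<bar> \<ge> R \<longrightarrow> norm (foxH_integrand m p a \<alpha> b \<beta> x s) \<le> C / (Im s)\<^sup>2"
    by blast
qed

lemma foxH_eq_vertical_line_integral:
  assumes \<alpha>: "\<And>i. i \<in> {1..p} \<Longrightarrow> \<alpha> i > 0" and \<beta>: "\<And>j. j \<in> {1..m} \<Longrightarrow> \<beta> j > 0"
    and \<Delta>: "foxH_Delta m p \<alpha> \<beta> > 0" and x: "x > 0"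
    and L: "foxH_contour m b \<beta> \<gamma> L" and c: "\<And>j. j \<in> {1..m} \<Longrightarrow> - b j / \<beta> j < c"
  shows "foxH L m p a \<alpha> b \<beta> x = (LINT t|lborel. foxH_integrand m p a \<alpha> b \<beta> x (Complex c t)) / (2 * of_real pi)"
    and "integrable lborel (\<lambda>t. foxH_integrand m p a \<alpha> b \<beta> x (Complex c t))"
proof -
  let ?P = "foxH_poles m b \<beta>"
  let ?f = "foxH_integrand m p a \<alpha> b \<beta> x"
  have P: "left_of_contour L z \<and> Im z = 0 \<and> Re z < c" if zP: "z \<in> ?P" for z
  proof -
    obtain j l where z: "j \<in> {1..m}" "z = foxH_pole b \<beta> j l"
      using foxH_polesE[OF zP] \<beta> by metis
    have "- (b j + real l) / \<beta> j \<le> - b j / \<beta> j" using \<beta>[OF z(1)] by (intro divide_right_mono) auto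
    also have "\<dots> < c" using c z by auto
    finally show ?thesis using L z by (auto simp: foxH_contour_def foxH_pole_def simp del: of_real_divide of_real_minus of_real_add)
  qed
  have decay: "strip_decay ?f" by (rule strip_decay_foxH_integrand[OF \<alpha> \<beta> \<Delta> x])
  have "((\<lambda>T. contour_integral (subpath (- T) T L) ?f) \<longlongrightarrow> \<i> * (LINT t|lborel. ?f (Complex c t))) at_top"
    using L P by (intro contour_integral_tendsto_vertical_line[OF _ holomorphic_foxH_integrand open_compl_foxH_poles _ _ decay])
       (auto simp: foxH_contour_def)
  hence "Lim at_top (\<lambda>T. contour_integral (subpath (- T) T L) ?f) = \<i> * (LINT t|lborel. ?f (Complex c t))"
    by (intro tendsto_Lim) auto
  thus "foxH L m p a \<alpha> b \<beta> x = (LINT t|lborel. ?f (Complex c t)) / (2 * of_real pi)"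
    by (simp add: foxH_def)
  show "integrable lborel (\<lambda>t. ?f (Complex c t))"
    using P by (intro Complex_line_integrable[OF holomorphic_foxH_integrand _ decay]) fastforce
qed

section \<open>Exponential decay at infinity\<close>

lemma one_plus_mult_le_powr:
  fixes N v :: real
  assumes "N \<ge> 1" "v \<ge> 0"
  shows "1 + N * v \<le> (1 + v) powr N"
proof -
  let ?f = "\<lambda>y. N * ln (1 + y) - ln (1 + N * y)"
  have "?f 0 \<le> ?f v"
  proof (rule DERIV_nonneg_imp_nondecreasing[OF assms(2)])
    fix y :: real assume y: "0 \<le> y" "y \<le> v"
    have Ny: "N * y \<ge> y" using assms(1) y mult_right_mono[of 1 N y] by simp
    have "(?f has_real_derivative N / (1 + y) - N / (1 + N * y)) (at y)"
      using assms y Ny by (auto intro!: derivative_eq_intros simp: divide_inverse)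
    moreover have "N / (1 + y) - N / (1 + N * y) \<ge> 0"
      using assms y Ny by (simp add: frac_le)
    ultimately show "\<exists>d. (?f has_real_derivative d) (at y) \<and> 0 \<le> d" by blast
  qed
  hence "ln (1 + N * v) \<le> N * ln (1 + v)" by simp
  hence "exp (ln (1 + N * v)) \<le> exp (N * ln (1 + v))" by simp
  moreover have "1 + N * v > 0" using assms by (simp add: add_pos_nonneg)
  ultimately show ?thesis using assms by (simp add: powr_def)
qed

text \<open>
  The general kernel bound contains the power \<open>\<mu> - \<Delta>\<sigma>\<close> of \<open>|s|/\<sigma> = (1 + (t/\<sigma>)\<^sup>2)\<^bsup>1/2\<^esup>\<close>. Bernoulli's inequality turns this
  large negative power into the profile \<open>1/(1 + \<Delta>t\<^sup>2/(4\<sigma>))\<close>, of width \<open>\<surd>\<sigma>\<close> like the Gaussian it stands for.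
\<close>

lemma foxH_kernel_saddle_bound:
  fixes a b \<alpha> \<beta> :: "nat \<Rightarrow> real"
  assumes \<alpha>: "\<And>i. i \<in> {1..p} \<Longrightarrow> \<alpha> i > 0" and \<beta>: "\<And>j. j \<in> {1..m} \<Longrightarrow> \<beta> j > 0"
    and \<Delta>: "foxH_Delta m p \<alpha> \<beta> > 0"
  defines "\<Delta>' \<equiv> foxH_Delta m p \<alpha> \<beta>" and "\<mu> \<equiv> foxH_mu m p a b" and "\<delta> \<equiv> foxH_delta m p \<alpha> \<beta>"
  obtains C R where "C > 0" "R > 0" "\<And>\<sigma> t. \<sigma> \<ge> R \<Longrightarrow>
    norm (foxH_kernel m p a \<alpha> b \<beta> (Complex \<sigma> t)) \<le>
      C * (\<sigma> powr \<mu> * exp (\<Delta>' * \<sigma> * ln \<sigma> - \<Delta>' * \<sigma> + ln \<delta> * \<sigma>)) * (1 / (1 + \<Delta>' / (4 * \<sigma>) * t\<^sup>2))"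
proof -
  obtain C R where C: "C > 0" and CR: "\<And>s. Re s > 0 \<Longrightarrow> norm s \<ge> R \<Longrightarrow> norm (foxH_kernel m p a \<alpha> b \<beta> s) \<le>
    C * exp ((\<mu> - \<Delta>' * Re s) * ln (norm s) + 2 * \<Delta>' * Re s * ln (Re s) - \<Delta>' * Re s + ln \<delta> * Re s)"
    using foxH_kernel_bound[of p \<alpha> m \<beta> a b] assms unfolding \<Delta>'_def \<mu>_def \<delta>_def by (metis less_imp_le)
  have D: "\<Delta>' > 0" using \<Delta> by (simp add: \<Delta>'_def)
  \<comment> \<open>makes the exponent \<open>N\<close> below at least \<open>1\<close> and at least \<open>\<Delta>\<sigma>/4\<close>\<close>
  define R' where "R' = max (max R 1) (max (2 * \<mu> / \<Delta>') ((\<mu> + 2) / \<Delta>'))"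
  show ?thesis
  proof (rule that[of C R'])
    show "C > 0" by fact
    show "R' > 0" by (simp add: R'_def less_max_iff_disj)
    fix \<sigma> t :: real assume "\<sigma> \<ge> R'"
    hence \<sigma>: "\<sigma> \<ge> R" "\<sigma> > 0" "2 * \<mu> \<le> \<Delta>' * \<sigma>" "\<mu> + 2 \<le> \<Delta>' * \<sigma>"
      using D by (auto simp: R'_def divide_le_eq mult.commute)
    define s where "s = Complex \<sigma> t"
    define N where "N = (\<Delta>' * \<sigma> - \<mu>) / 2"
    have N: "N \<ge> 1" "N \<ge> \<Delta>' * \<sigma> / 4" using \<sigma> by (auto simp: N_def)
    define v where "v = (t / \<sigma>)\<^sup>2"
    have v: "v \<ge> 0" by (simp add: v_def)
    have ns: "norm s \<ge> \<sigma>" using abs_Re_le_cmod[of s] \<sigma> by (simp add: s_def)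
    have lns: "2 * (ln (norm s) - ln \<sigma>) = ln (1 + v)"
      using ln_one_plus_slope_square[of s] \<sigma> by (simp add: s_def v_def)
    have "(\<mu> - \<Delta>' * \<sigma>) * ln (norm s) + 2 * \<Delta>' * \<sigma> * ln \<sigma> - \<Delta>' * \<sigma> + ln \<delta> * \<sigma>
       = \<mu> * ln \<sigma> + (\<Delta>' * \<sigma> * ln \<sigma> - \<Delta>' * \<sigma> + ln \<delta> * \<sigma>) - N * ln (1 + v)"
      unfolding lns[symmetric] N_def by (simp add: algebra_simps diff_divide_distrib)
    moreover have "norm (foxH_kernel m p a \<alpha> b \<beta> s) \<le>
        C * exp ((\<mu> - \<Delta>' * \<sigma>) * ln (norm s) + 2 * \<Delta>' * \<sigma> * ln \<sigma> - \<Delta>' * \<sigma> + ln \<delta> * \<sigma>)"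
      using CR[of s] \<sigma> ns by (simp add: s_def)
    ultimately have "norm (foxH_kernel m p a \<alpha> b \<beta> s) \<le>
        C * exp (\<mu> * ln \<sigma> + (\<Delta>' * \<sigma> * ln \<sigma> - \<Delta>' * \<sigma> + ln \<delta> * \<sigma>) - N * ln (1 + v))"
      by (simp only:)
    also have "\<dots> = C * (\<sigma> powr \<mu> * exp (\<Delta>' * \<sigma> * ln \<sigma> - \<Delta>' * \<sigma> + ln \<delta> * \<sigma>)) * (1 / (1 + v) powr N)"
      using \<sigma> v by (simp add: powr_def exp_diff exp_add)
    also have "\<dots> \<le> C * (\<sigma> powr \<mu> * exp (\<Delta>' * \<sigma> * ln \<sigma> - \<Delta>' * \<sigma> + ln \<delta> * \<sigma>)) * (1 / (1 + \<Delta>' / (4 * \<sigma>) * t\<^sup>2))"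
    proof (intro mult_left_mono divide_left_mono)
      have "\<Delta>' / (4 * \<sigma>) * t\<^sup>2 = (\<Delta>' * \<sigma> / 4) * v"
        using \<sigma> by (simp add: v_def field_simps power2_eq_square)
      also have "\<dots> \<le> N * v" using N v by (intro mult_right_mono)
      finally show "1 + \<Delta>' / (4 * \<sigma>) * t\<^sup>2 \<le> (1 + v) powr N"
        using one_plus_mult_le_powr[OF N(1) v] by linarith
      have "1 + \<Delta>' / (4 * \<sigma>) * t\<^sup>2 > 0" using D \<sigma> by (intro add_pos_nonneg) auto
      thus "0 < (1 + v) powr N * (1 + \<Delta>' / (4 * \<sigma>) * t\<^sup>2)" using v by (intro mult_pos_pos) auto
    qed (use C in auto)
    finally show "norm (foxH_kernel m p a \<alpha> b \<beta> (Complex \<sigma> t)) \<le>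
      C * (\<sigma> powr \<mu> * exp (\<Delta>' * \<sigma> * ln \<sigma> - \<Delta>' * \<sigma> + ln \<delta> * \<sigma>)) * (1 / (1 + \<Delta>' / (4 * \<sigma>) * t\<^sup>2))"
      by (simp add: s_def)
  qed
qed

lemma foxH_delta_pos:
  assumes "\<And>i. i \<in> {1..p} \<Longrightarrow> \<alpha> i > 0" "\<And>j. j \<in> {1..m} \<Longrightarrow> \<beta> j > 0"
  shows "foxH_delta m p \<alpha> \<beta> > 0"
  unfolding foxH_delta_def using assms by (intro mult_pos_pos prod_pos) force+

text \<open>
  On the line through \<open>\<sigma> = (x/\<delta>)\<^bsup>1/\<Delta>\<^esup>\<close> one has \<open>ln x = ln \<delta> + \<Delta> ln \<sigma>\<close>, so \<open>x\<^bsup>-\<sigma>\<^esup>\<close> cancels the factor \<open>\<sigma>\<^bsup>\<Delta>\<sigma>\<^esup> \<delta>\<^sup>\<sigma>\<close> of the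
  kernel bound and \<open>\<sigma>\<^sup>\<mu> e\<^bsup>-\<Delta>\<sigma>\<^esup>\<close> remains.
\<close>

lemma foxH_bigo_at_top:
  assumes \<alpha>: "\<And>i. i \<in> {1..p} \<Longrightarrow> \<alpha> i > 0" and \<beta>: "\<And>j. j \<in> {1..m} \<Longrightarrow> \<beta> j > 0"
    and L: "foxH_contour m b \<beta> \<gamma> L" and \<Delta>: "foxH_Delta m p \<alpha> \<beta> > 0"
  shows "foxH L m p a \<alpha> b \<beta> \<in>
           O[at_top](\<lambda>x. complex_of_real
             (x powr ((foxH_mu m p a b + 1 / 2) / foxH_Delta m p \<alpha> \<beta>) *
              exp (- foxH_Delta m p \<alpha> \<beta> *
                   foxH_delta m p \<alpha> \<beta> powr (- 1 / foxH_Delta m p \<alpha> \<beta>) *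
                   x powr (1 / foxH_Delta m p \<alpha> \<beta>))))"
proof -
  define \<Delta>' \<mu> where "\<Delta>' = foxH_Delta m p \<alpha> \<beta>" and "\<mu> = foxH_mu m p a b"
  define \<delta> where "\<delta> = foxH_delta m p \<alpha> \<beta>"
  have D: "\<Delta>' > 0" using \<Delta> by (simp add: \<Delta>'_def)
  have \<delta>: "\<delta> > 0" unfolding \<delta>_def using \<alpha> \<beta> by (rule foxH_delta_pos)
  obtain C R where C: "C > 0" "R > 0" and CR: "\<And>\<sigma> t. \<sigma> \<ge> R \<Longrightarrow>
    norm (foxH_kernel m p a \<alpha> b \<beta> (Complex \<sigma> t)) \<le>
      C * (\<sigma> powr \<mu> * exp (\<Delta>' * \<sigma> * ln \<sigma> - \<Delta>' * \<sigma> + ln \<delta> * \<sigma>)) * (1 / (1 + \<Delta>' / (4 * \<sigma>) * t\<^sup>2))"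
    using foxH_kernel_saddle_bound[OF \<alpha> \<beta> \<Delta>, of a b] unfolding \<Delta>'_def \<mu>_def \<delta>_def by blast
  define c where "c = (\<lambda>x. (x / \<delta>) powr (1 / \<Delta>'))"
  define R' where "R' = max R (1 + (\<Sum>j=1..m. \<bar>b j / \<beta> j\<bar>))"
  have R': "- b j / \<beta> j < R'" if "j \<in> {1..m}" for j
  proof -
    have "\<bar>b j / \<beta> j\<bar> \<le> (\<Sum>j=1..m. \<bar>b j / \<beta> j\<bar>)"
      using that by (intro member_le_sum) auto
    hence "\<bar>b j / \<beta> j\<bar> < R'" by (simp add: R'_def)
    thus ?thesis unfolding minus_divide_left[symmetric] by linarith
  qed
  have lim: "filterlim c at_top at_top"
    unfolding c_def using D \<delta> by real_asymp
  define K where "K = C / sqrt \<Delta>' * \<delta> powr (- ((\<mu> + 1/2) / \<Delta>'))"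
  have bound: "norm (foxH L m p a \<alpha> b \<beta> x) \<le> K * (x powr ((\<mu> + 1 / 2) / \<Delta>') *
              exp (- \<Delta>' * \<delta> powr (- 1 / \<Delta>') * x powr (1 / \<Delta>')))"
    if x: "x > 0" and cx: "c x \<ge> R'" for x
  proof -
    define \<sigma> where "\<sigma> = c x"
    have \<sigma>: "\<sigma> \<ge> R" "\<sigma> > 0" using cx C by (auto simp: \<sigma>_def R'_def)
    have line: "- b j / \<beta> j < \<sigma>" if "j \<in> {1..m}" for j
      using R'[OF that] cx by (simp add: \<sigma>_def)
    let ?f = "\<lambda>t. foxH_integrand m p a \<alpha> b \<beta> x (Complex \<sigma> t)"
    have F: "foxH L m p a \<alpha> b \<beta> x = (LINT t|lborel. ?f t) / (2 * of_real pi)" "integrable lborel ?f"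
      by (rule foxH_eq_vertical_line_integral[OF \<alpha> \<beta> \<Delta> x L line]; assumption)+
    have lnx: "ln x = ln \<delta> + \<Delta>' * ln \<sigma>"
      using x \<delta> D by (simp add: \<sigma>_def c_def ln_powr ln_div)
    define A where "A = C * (\<sigma> powr \<mu> * exp (- \<Delta>' * \<sigma>))"
    have pt: "norm (?f t) \<le> A * (1 / (1 + \<Delta>' / (4 * \<sigma>) * t\<^sup>2))" for t
    proof -
      have "norm (?f t) = norm (foxH_kernel m p a \<alpha> b \<beta> (Complex \<sigma> t)) * x powr (- \<sigma>)"
        using x by (simp add: norm_foxH_integrand)
      also have "\<dots> \<le> (C * (\<sigma> powr \<mu> * exp (\<Delta>' * \<sigma> * ln \<sigma> - \<Delta>' * \<sigma> + ln \<delta> * \<sigma>)) * (1 / (1 + \<Delta>' / (4 * \<sigma>) * t\<^sup>2))) * x powr (- \<sigma>)"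
        by (intro mult_right_mono CR \<sigma>) auto
      also have "\<dots> = C * (\<sigma> powr \<mu> * (exp (\<Delta>' * \<sigma> * ln \<sigma> - \<Delta>' * \<sigma> + ln \<delta> * \<sigma>) * x powr (- \<sigma>))) * (1 / (1 + \<Delta>' / (4 * \<sigma>) * t\<^sup>2))"
        by (simp only: mult_ac)
      also have "exp (\<Delta>' * \<sigma> * ln \<sigma> - \<Delta>' * \<sigma> + ln \<delta> * \<sigma>) * x powr (- \<sigma>) = exp (- \<Delta>' * \<sigma>)"
        using x by (simp add: powr_def lnx algebra_simps flip: exp_add)
      finally show ?thesis by (simp add: A_def)
    qed
    have k: "\<Delta>' / (4 * \<sigma>) > 0" using D \<sigma> by simp
    note I = has_bochner_integral_inverse_one_plus_scaled_square[OF k]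
    have "norm (LINT t|lborel. ?f t) \<le> (LINT t|lborel. norm (?f t))"
      by (rule integral_norm_bound)
    also have "\<dots> \<le> (LINT t|lborel. A * (1 / (1 + \<Delta>' / (4 * \<sigma>) * t\<^sup>2)))"
      using F(2) I pt by (intro integral_mono integrable_norm integrable_mult_right) (auto simp: has_bochner_integral_iff)
    also have "\<dots> = A * (pi / sqrt (\<Delta>' / (4 * \<sigma>)))"
      using I by (subst integral_mult_right_zero) (simp add: has_bochner_integral_iff)
    also have "pi / sqrt (\<Delta>' / (4 * \<sigma>)) = 2 * pi * (\<sigma> powr (1/2) / sqrt \<Delta>')"
      using \<sigma> D by (simp add: real_sqrt_divide real_sqrt_mult powr_half_sqrt field_simps)
    finally have "norm (foxH L m p a \<alpha> b \<beta> x) \<le> A * (\<sigma> powr (1/2) / sqrt \<Delta>')"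
      unfolding F(1) by (simp add: norm_divide norm_mult field_simps)
    also have "\<dots> = C / sqrt \<Delta>' * (\<sigma> powr (\<mu> + 1/2) * exp (- \<Delta>' * \<sigma>))"
      by (simp add: A_def powr_add)
    also have "\<sigma> powr (\<mu> + 1/2) = \<delta> powr (- ((\<mu> + 1/2) / \<Delta>')) * x powr ((\<mu> + 1/2) / \<Delta>')"
      using x \<delta> by (simp add: \<sigma>_def c_def powr_powr powr_divide powr_minus field_simps)
    also have "\<sigma> = \<delta> powr (- 1 / \<Delta>') * x powr (1 / \<Delta>')"
      using x \<delta> by (simp add: \<sigma>_def c_def powr_divide powr_minus field_simps)
    finally show ?thesis by (simp add: K_def mult.assoc)
  qed
  have "eventually (\<lambda>x. x > 0 \<and> c x \<ge> R') at_top"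
    using eventually_gt_at_top[of 0] lim[unfolded filterlim_at_top, rule_format, of R']
    by eventually_elim simp
  hence "eventually (\<lambda>x. norm (foxH L m p a \<alpha> b \<beta> x) \<le> K * norm (complex_of_real (x powr ((\<mu> + 1 / 2) / \<Delta>') *
              exp (- \<Delta>' * \<delta> powr (- 1 / \<Delta>') * x powr (1 / \<Delta>'))))) at_top"
    unfolding norm_of_real by eventually_elim (use bound in \<open>simp add: abs_mult\<close>)
  thus ?thesis unfolding \<Delta>'_def \<mu>_def \<delta>_def by (rule bigoI)
qed

section \<open>The behaviour at zero\<close>

text \<open>
  The reciprocal of the numerator is a product of entire functions \<open>rGamma\<close>. Two factors vanishing at \<open>z\<close> would give
  it a zero of order at least two, hence the numerator a multiple pole.
\<close>

lemma simple_pole_of_numerator_unique: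
  assumes "simple_pole_at (foxH_numerator m b \<beta>) z"
    and "j \<in> {1..m}" "of_real (b j) + z * of_real (\<beta> j) \<in> \<int>\<^sub>\<le>\<^sub>0"
    and "k \<in> {1..m}" "of_real (b k) + z * of_real (\<beta> k) \<in> \<int>\<^sub>\<le>\<^sub>0"
  shows "j = k"
proof (rule ccontr)
  assume neq: "j \<noteq> k"
  define g where "g = (\<lambda>j s. rGamma (of_real (b j) + s * of_real (\<beta> j) :: complex))"
  define h where "h = (\<lambda>s. \<Prod>j\<in>{1..m}. g j s)"
  have pole: "is_pole (foxH_numerator m b \<beta>) z" "zorder (foxH_numerator m b \<beta>) z = - 1"
    using assms(1) by (auto simp: simple_pole_at_def)
  have num: "foxH_numerator m b \<beta> = (\<lambda>s. inverse (h s))"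
    by (auto simp: foxH_numerator_def h_def g_def Gamma_def o_def fun_eq_iff simp flip: prod_inversef)
  have hnz: "eventually (\<lambda>s. h s \<noteq> 0) (at z)"
    using non_zero_neighbour_pole[OF pole(1)] unfolding num by eventually_elim auto
  have g_an: "g i analytic_on {z}" for i
    unfolding g_def by (intro analytic_intros)
  have h_an: "h analytic_on {z}" unfolding h_def using g_an by (intro analytic_intros)
  have gnz: "frequently (\<lambda>s. g i s \<noteq> 0) (at z)" if "i \<in> {1..m}" for i
  proof -
    have "eventually (\<lambda>s. g i s \<noteq> 0) (at z)"
      using hnz by eventually_elim (use that in \<open>auto simp: h_def\<close>)
    thus ?thesis by (simp add: eventually_frequently)
  qed
  have "zorder (foxH_numerator m b \<beta>) z = - zorder h z"
    unfolding num using h_an hnz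
    by (intro zorder_inverse isolated_singularity_at_analytic not_essential_analytic) (auto simp: eventually_frequently)
  hence h1: "zorder h z = 1" using pole by simp
  have nonneg: "zorder (g i) z \<ge> 0" if "i \<in> {1..m}" for i
    using g_an gnz[OF that] by (rule zorder_ge_0)
  have pos: "zorder (g i) z \<ge> 1" if "i \<in> {j, k}" for i
  proof -
    have "g i z = 0" "i \<in> {1..m}" using that assms by (auto simp: g_def rGamma_eq_zero_iff)
    thus ?thesis using zorder_pos_iff'[OF g_an gnz] by force
  qed
  have "2 \<le> (\<Sum>i\<in>{j, k}. zorder (g i) z)"
    using neq pos[of j] pos[of k] by simp
  also have "\<dots> \<le> (\<Sum>i\<in>{1..m}. zorder (g i) z)"
    using assms nonneg by (intro sum_mono2) auto
  also have "\<dots> = zorder h z"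
    using g_an hnz unfolding h_def by (intro zorder_prod_analytic[symmetric])
  finally show False using h1 by simp
qed

text \<open>
  The strict gap leaves a strip to the left of \<open>-\<rho>\<close> that contains no other pole. Rewriting the one singular factor by
  \<open>\<Gamma>(z) = \<Gamma>(z + 1)/z\<close> exhibits the pole, and the line inside the strip contributes \<open>O(x\<^bsup>\<rho> + \<eta>/2\<^esup>)\<close>.
\<close>

lemma foxH_bigo_at_right_0:
  assumes \<alpha>: "\<And>i. i \<in> {1..p} \<Longrightarrow> \<alpha> i > 0" and \<beta>: "\<And>j. j \<in> {1..m} \<Longrightarrow> \<beta> j > 0"
    and L: "foxH_contour m b \<beta> \<gamma> L" and \<Delta>: "foxH_Delta m p \<alpha> \<beta> > 0"
    and k: "k \<in> {1..m}" and gap: "\<And>j. j \<in> {1..m} - {k} \<Longrightarrow> b k / \<beta> k < b j / \<beta> j"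
  shows "foxH L m p a \<alpha> b \<beta> \<in> O[at_right 0](\<lambda>x. complex_of_real (x powr (b k / \<beta> k)))"
proof -
  define \<rho> where "\<rho> = b k / \<beta> k"
  \<comment> \<open>distance from \<open>-\<rho>\<close> to the next pole, where \<open>1/\<beta>\<^sub>k\<close> is the spacing of the poles of the \<open>k\<close>-th factor\<close>
  define \<eta> where "\<eta> = Min (insert (1 / \<beta> k) ((\<lambda>j. b j / \<beta> j - \<rho>) ` ({1..m} - {k})))"
  have \<eta>: "\<eta> > 0" unfolding \<eta>_def using \<beta>[OF k] gap by (subst Min_gr_iff) (auto simp: \<rho>_def)
  have \<eta>k: "\<eta> \<le> 1 / \<beta> k" unfolding \<eta>_def by (intro Min_le) auto
  have \<eta>j: "\<eta> \<le> b j / \<beta> j - \<rho>" if "j \<in> {1..m} - {k}" for j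
    unfolding \<eta>_def using that by (intro Min_le) auto
  define S where "S = {s. Re s > - \<rho> - \<eta>}"
  define z where "z = complex_of_real (- \<rho>)"
  define G0 where "G0 = (\<lambda>s::complex. (\<Prod>j\<in>{1..m}-{k}. Gamma (of_real (b j) + s * of_real (\<beta> j))) *
     (Gamma (of_real (b k) + s * of_real (\<beta> k) + 1) / of_real (\<beta> k)) *
     (\<Prod>i=1..p. rGamma (of_real (a i) + s * of_real (\<alpha> i))))"
  define c' where "c' = - \<rho> - \<eta> / 2"
  have away: "of_real (b j) + s * of_real (\<beta> j) \<notin> \<int>\<^sub>\<le>\<^sub>0" if "s \<in> S" "j \<in> {1..m} - {k}" for j s
  proof -
    have bj: "\<beta> j > 0" using that \<beta> by auto
    have "- Re s < b j / \<beta> j" using that \<eta>j[of j] by (auto simp: S_def)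
    hence "b j + Re s * \<beta> j > 0" using bj by (simp add: field_simps)
    thus ?thesis by (auto elim!: nonpos_Ints_cases simp: complex_eq_iff)
  qed
  have away_k: "of_real (b k) + s * of_real (\<beta> k) + 1 \<notin> \<int>\<^sub>\<le>\<^sub>0" if "s \<in> S" for s
  proof -
    have bk: "\<beta> k > 0" using k \<beta> by auto
    have "- Re s < b k / \<beta> k + 1 / \<beta> k" using that \<eta>k by (auto simp: S_def \<rho>_def)
    hence "b k + Re s * \<beta> k + 1 > 0" using bk by (simp add: field_simps)
    thus ?thesis by (auto elim!: nonpos_Ints_cases simp: complex_eq_iff)
  qed
  have G0_hol: "G0 holomorphic_on S"
    unfolding G0_def using away away_k \<beta>[OF k] by (intro holomorphic_intros) auto
  have kernel: "foxH_kernel m p a \<alpha> b \<beta> s = G0 s / (s - z)" if s: "s \<in> S" "s \<noteq> z" for s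
  proof -
    have bk: "\<beta> k > 0" using k \<beta> by auto
    have w: "of_real (b k) + s * of_real (\<beta> k) = (s - z) * of_real (\<beta> k)"
      using bk by (simp add: z_def \<rho>_def field_simps)
    have "Gamma (of_real (b k) + s * of_real (\<beta> k) + 1) = (of_real (b k) + s * of_real (\<beta> k)) * Gamma (of_real (b k) + s * of_real (\<beta> k))"
    proof (rule Gamma_plus1)
      show "of_real (b k) + s * of_real (\<beta> k) \<notin> \<int>\<^sub>\<le>\<^sub>0"
      proof
        assume "of_real (b k) + s * of_real (\<beta> k) \<in> \<int>\<^sub>\<le>\<^sub>0"
        then obtain n :: nat where n: "of_real (b k) + s * of_real (\<beta> k) = - of_nat n"
          by (auto elim!: nonpos_Ints_cases')
        show False
        proof (cases n)
          case 0
          thus False using n w s bk by simp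
        next
          case (Suc n')
          hence "of_real (b k) + s * of_real (\<beta> k) + 1 = - of_nat n'" using n by simp
          thus False using away_k[OF s(1)] by simp
        qed
      qed
    qed
    hence "Gamma (of_real (b k) + s * of_real (\<beta> k)) = Gamma (of_real (b k) + s * of_real (\<beta> k) + 1) / of_real (\<beta> k) / (s - z)"
      unfolding w using s bk by simp
    moreover have "foxH_numerator m b \<beta> s = Gamma (of_real (b k) + s * of_real (\<beta> k)) * (\<Prod>j\<in>{1..m}-{k}. Gamma (of_real (b j) + s * of_real (\<beta> j)))"
      unfolding foxH_numerator_def using k by (subst prod.remove[of _ k]) auto
    ultimately show ?thesis by (simp add: foxH_kernel_altdef G0_def)
  qed
  have c'S: "Complex c' t \<in> S" "Complex c' t \<noteq> z" for t
    using \<eta> by (auto simp: c'_def S_def z_def complex_eq_iff)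
  have k1: "integrable lborel (\<lambda>t. foxH_kernel m p a \<alpha> b \<beta> (Complex c' t))"
  proof -
    have one: "foxH_kernel m p a \<alpha> b \<beta> = foxH_integrand m p a \<alpha> b \<beta> 1"
      by (auto simp: fun_eq_iff foxH_integrand_altdef)
    have "(\<lambda>s. G0 s / (s - z)) holomorphic_on S - {z}"
      using G0_hol by (auto intro!: holomorphic_intros elim: holomorphic_on_subset)
    hence "foxH_kernel m p a \<alpha> b \<beta> holomorphic_on S - {z}"
      by (rule holomorphic_transform) (use kernel in auto)
    thus ?thesis
      by (rule Complex_line_integrable)
         (use c'S in \<open>auto simp: one intro!: strip_decay_foxH_integrand[OF \<alpha> \<beta> \<Delta>]\<close>)
  qed
  define M where "M = (LINT t|lborel. norm (foxH_kernel m p a \<alpha> b \<beta> (Complex c' t)))"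
  have M: "M \<ge> 0" unfolding M_def by (intro integral_nonneg_AE) auto
  have line: "- b j / \<beta> j < - \<rho> + 1" if "j \<in> {1..m}" for j
    using \<eta>j[of j] \<eta> that by (cases "j = k") (auto simp: \<rho>_def)
  have bound: "norm (foxH L m p a \<alpha> b \<beta> x) \<le> (norm (G0 z) + M / (2 * pi)) * x powr \<rho>" if x: "0 < x" "x < 1" for x
  proof -
    let ?f = "foxH_integrand m p a \<alpha> b \<beta> x"
    define G where "G = (\<lambda>s. G0 s * complex_of_real x powr (- s))"
    have "G holomorphic_on {s. Re s > - \<rho> - \<eta>}"
      using G0_hol unfolding G_def S_def by (intro holomorphic_intros)
    moreover have "?f w = G w / (w - z)" if "Re w > - \<rho> - \<eta>" "w \<noteq> z" for w
      using kernel[of w] that by (simp add: foxH_integrand_altdef G_def S_def)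
    ultimately have "(LINT t|lborel. ?f (Complex (- \<rho> + 1) t)) = (LINT t|lborel. ?f (Complex c' t)) + 2 * of_real pi * G z"
      using \<eta> x by (intro shift_line_past_simple_pole[where l = "- \<rho> - \<eta>"] strip_decay_foxH_integrand[OF \<alpha> \<beta> \<Delta>])
        (auto simp: c'_def z_def)
    hence "foxH L m p a \<alpha> b \<beta> x = (LINT t|lborel. ?f (Complex c' t)) / (2 * of_real pi) + G z"
      using foxH_eq_vertical_line_integral(1)[OF \<alpha> \<beta> \<Delta> x(1) L line, of a] by (simp add: add_divide_distrib)
    hence "norm (foxH L m p a \<alpha> b \<beta> x) \<le> norm (LINT t|lborel. ?f (Complex c' t)) / (2 * pi) + norm (G z)"
      using norm_triangle_ineq[of "(LINT t|lborel. ?f (Complex c' t)) / (2 * of_real pi)" "G z"]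
      by (simp add: norm_divide norm_mult)
    also have "norm (G z) = norm (G0 z) * x powr \<rho>"
      using x by (simp add: G_def z_def norm_mult norm_powr_real_powr)
    also have "norm (LINT t|lborel. ?f (Complex c' t)) \<le> M * x powr \<rho>"
    proof -
      have "norm (LINT t|lborel. ?f (Complex c' t)) \<le> (LINT t|lborel. norm (?f (Complex c' t)))"
        by (rule integral_norm_bound)
      also have "\<dots> = M * x powr (- c')" unfolding M_def using x by (simp add: norm_foxH_integrand)
      also have "x powr (- c') \<le> x powr \<rho>" using x \<eta> by (intro powr_mono') (auto simp: c'_def)
      finally show ?thesis using M by (simp add: mult_left_mono)
    qed
    finally show ?thesis by (simp add: algebra_simps divide_right_mono)
  qed
  have "eventually (\<lambda>x::real. 0 < x \<and> x < 1) (at_right 0)"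
    by (rule eventually_mono[OF eventually_at_right_real[of 0 1]]) auto
  hence "eventually (\<lambda>x. norm (foxH L m p a \<alpha> b \<beta> x) \<le> (norm (G0 z) + M / (2 * pi)) * norm (complex_of_real (x powr (b k / \<beta> k)))) (at_right 0)"
    unfolding norm_of_real by eventually_elim (use bound in \<open>simp add: \<rho>_def\<close>)
  thus ?thesis by (rule bigoI)
qed

theorem corollary7:
  fixes m p :: nat
    and a \<alpha> b \<beta> :: "nat \<Rightarrow> real"
    and \<gamma> :: real
    and L :: "real \<Rightarrow> complex"
  assumes "\<And>i. i \<in> {1..p} \<Longrightarrow> \<alpha> i > 0"
    and "\<And>i. i \<in> {1..p} \<Longrightarrow> a i + \<alpha> i > 0"
    and "\<And>j. j \<in> {1..m} \<Longrightarrow> \<beta> j > 0"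
    and "\<And>j. j \<in> {1..m} \<Longrightarrow> b j + \<beta> j > 0"
    and "foxH_contour m b \<beta> \<gamma> L"
    and "\<And>x. x > 0 \<Longrightarrow> foxH L m p a \<alpha> b \<beta> x \<in> \<real>\<^sub>\<ge>\<^sub>0"
    and "foxH_Delta m p \<alpha> \<beta> > 0"
    and "\<And>j l. j \<in> {1..m} \<Longrightarrow> simple_pole_at (foxH_numerator m b \<beta>) (foxH_pole b \<beta> j l)"
  shows "foxH L m p a \<alpha> b \<beta> \<in>
           O[at_top](\<lambda>x. complex_of_real
             (x powr ((foxH_mu m p a b + 1 / 2) / foxH_Delta m p \<alpha> \<beta>) *
              exp (- foxH_Delta m p \<alpha> \<beta> *
                   foxH_delta m p \<alpha> \<beta> powr (- 1 / foxH_Delta m p \<alpha> \<beta>) *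
                   x powr (1 / foxH_Delta m p \<alpha> \<beta>))))
       \<and> foxH L m p a \<alpha> b \<beta> \<in>
           O[at_right 0](\<lambda>x. complex_of_real (x powr foxH_rho m b \<beta>))
       \<and> foxH_rho m b \<beta> > - 1"
proof (intro conjI)
  show "foxH L m p a \<alpha> b \<beta> \<in>
           O[at_top](\<lambda>x. complex_of_real
             (x powr ((foxH_mu m p a b + 1 / 2) / foxH_Delta m p \<alpha> \<beta>) *
              exp (- foxH_Delta m p \<alpha> \<beta> *
                   foxH_delta m p \<alpha> \<beta> powr (- 1 / foxH_Delta m p \<alpha> \<beta>) *
                   x powr (1 / foxH_Delta m p \<alpha> \<beta>))))"
    using assms(1,3,5,7) by (rule foxH_bigo_at_top)
  have "m \<noteq> 0"
  proof
    assume "m = 0"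
    moreover have "(\<Sum>i=1..p. \<alpha> i) \<ge> 0" using assms(1) by (intro sum_nonneg) (force intro: less_imp_le)
    ultimately show False using assms(7) by (simp add: foxH_Delta_def)
  qed
  hence ne: "(\<lambda>j. b j / \<beta> j) ` {1..m} \<noteq> {}" by auto
  have "foxH_rho m b \<beta> \<in> (\<lambda>j. b j / \<beta> j) ` {1..m}"
    unfolding foxH_rho_def by (rule Min_in) (use ne in auto)
  then obtain k where k: "k \<in> {1..m}" "foxH_rho m b \<beta> = b k / \<beta> k" by auto
  show "foxH_rho m b \<beta> > - 1"
    using assms(3,4)[OF k(1)] by (simp add: k(2) field_simps)
  have pole: "foxH_pole b \<beta> k 0 = of_real (- (b k / \<beta> k))" by (simp add: foxH_pole_def)
  have zero: "of_real (b j) + foxH_pole b \<beta> k 0 * of_real (\<beta> j) \<in> \<int>\<^sub>\<le>\<^sub>0"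
    if "j \<in> {1..m}" "b j / \<beta> j = b k / \<beta> k" for j
  proof -
    have "b j - b k / \<beta> k * \<beta> j = 0" using assms(3)[OF that(1)] that(2) by (simp add: field_simps)
    moreover have "of_real (b j) + foxH_pole b \<beta> k 0 * of_real (\<beta> j) = complex_of_real (b j - b k / \<beta> k * \<beta> j)"
      unfolding pole by simp
    ultimately show ?thesis by simp
  qed
  have "b k / \<beta> k < b j / \<beta> j" if j: "j \<in> {1..m} - {k}" for j
  proof -
    have "b k / \<beta> k \<le> b j / \<beta> j"
      using j unfolding k(2)[symmetric] foxH_rho_def by (intro Min_le) auto
    moreover have "b j / \<beta> j \<noteq> b k / \<beta> k"
      using simple_pole_of_numerator_unique[OF assms(8)[OF k(1), of 0] _ zero k(1) zero] j k(1) by blast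
    ultimately show ?thesis by simp
  qed
  with assms(1,3,5,7) k(1) show "foxH L m p a \<alpha> b \<beta> \<in> O[at_right 0](\<lambda>x. complex_of_real (x powr foxH_rho m b \<beta>))"
    unfolding k(2) by (rule foxH_bigo_at_right_0)
qed

end
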